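(* For every sufficiently small constant $\varepsilon^0>0$ there exist $\varepsilon^*$ with $0<\varepsilon^*<\varepsilon^0$ and a finite point set $S\subset\mathbb{R}^2$ such that every set $T\subset\mathbb{R}^2$ (not necessarily contained in $S$) which contains a point of every line containing at least $\varepsilon^*|S|$ points of $S$ (i.e., every weak $\varepsilon^*$-net of $S$ for lines) satisfies $$|T|\ge \frac{1}{10\varepsilon^*}\Big(\log\log\frac{1}{\varepsilon^*}\Big)^{1/10}.$$
   Context: Logarithms are to base 2. For a finite point set $S$ in the plane, a set $T\subset\mathbb{R}^2$ is a weak $\varepsilon$-net (with respect to lines) if every line $\ell$ with $|\ell\cap S|\ge\varepsilon|S|$ contains a point of $T$. *)

theory Defs
  imports Complex_Main
begin

definition plane_lines :: "(real \<times> real) set set" where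
  "plane_lines = {L. \<exists>a b c. (a \<noteq> 0 \<or> b \<noteq> 0) \<and> L = {(x, y). a * x + b * y = c}}"

definition weak_eps_net_lines :: "real \<Rightarrow> (real \<times> real) set \<Rightarrow> (real \<times> real) set \<Rightarrow> bool" where
  "weak_eps_net_lines eps S T \<longleftrightarrow>
     (\<forall>L\<in>plane_lines. real (card (L \<inter> S)) \<ge> eps * real (card S) \<longrightarrow> L \<inter> T \<noteq> {})"

end

theory Submission
  imports Defs "HOL-Library.FuncSet" "HOL-Computational_Algebra.Polynomial"
begin

text \<open>
Take the axis-parallel lines of a grid with side \<open>n\<close> in very high dimension \<open>d\<close> and a sparse random
set of \<open>N\<close> grid points. If some \<open>N/3\<close> of the sample points had no \<open>k\<close> on a common line, reveal them one by
one and record, for each \<open>j < k\<close>, a family of lines already carrying \<open>j\<close> revealed points. Each new point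
either pushes many lines to the next level, which a bounded potential permits only rarely, or falls
into a set of density at most \<open>1/128\<close>. Such sequences are therefore so rare that a union bound over all
\<open>2^N\<close> index sets succeeds. Deleting a few points leaves a set \<open>S\<close> with at most \<open>k\<close> points on every line, such that
each half of \<open>S\<close> contains all points of \<open>S\<close> on some \<open>k\<close>-point line, and such that a grid point outside \<open>S\<close>
lies on at most one \<open>k\<close>-point line.

A generic linear projection to the plane creates no new concurrency of three lines, so a point
outside the image of \<open>S\<close> meets at most two \<open>k\<close>-point lines and can be traded for two points of \<open>S\<close>. Hence
every weak net for \<open>\<epsilon> = k/|S|\<close> has at least \<open>|S|/4\<close> points, while \<open>log log (1/\<epsilon>)\<close> is
polynomial in \<open>k\<close>.
\<close>

section \<open>Sequential exposure in a regular linear space\<close>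

text \<open>A uniform, regular partial linear space: two lines share at most one point, but two
  points need not be joined.\<close>

locale linear_space =
  fixes V :: "'a set" and \<L> :: "'a set set" and n d :: nat
  assumes finite_V: "finite V" and V_nonempty: "V \<noteq> {}"
    and line_subset: "\<And>l. l \<in> \<L> \<Longrightarrow> l \<subseteq> V"
    and card_line: "\<And>l. l \<in> \<L> \<Longrightarrow> card l = n"
    and card_lines_through: "\<And>x. x \<in> V \<Longrightarrow> card {l \<in> \<L>. x \<in> l} = d"
    and lines_meet_once: "\<And>l l' x y. l \<in> \<L> \<Longrightarrow> l' \<in> \<L> \<Longrightarrow> l \<noteq> l' \<Longrightarrow>
        x \<in> l \<Longrightarrow> x \<in> l' \<Longrightarrow> y \<in> l \<Longrightarrow> y \<in> l' \<Longrightarrow> x = y"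
begin

lemma finite_lines: "finite \<L>"
proof (rule finite_subset)
  show "\<L> \<subseteq> Pow V" using line_subset by auto
  show "finite (Pow V)" using finite_V by simp
qed

lemma finite_line: "l \<in> \<L> \<Longrightarrow> finite l"
  using finite_subset[OF line_subset finite_V] .

end

definition degree_in :: "'a set set \<Rightarrow> 'a \<Rightarrow> nat" where
  "degree_in A x = card {l \<in> A. x \<in> l}"

lemma sum_degree_in:
  assumes "finite A" "finite B"
  shows "(\<Sum>x\<in>B. degree_in A x) = (\<Sum>l\<in>A. card (l \<inter> B))"
proof -
  have "(\<Sum>x\<in>B. card {l \<in> A. x \<in> l}) = (\<Sum>l\<in>A. card {x \<in> B. x \<in> l})"
    by (intro sum_multicount_gen) (use assms in auto)
  moreover have "{x \<in> B. x \<in> l} = l \<inter> B" for l by auto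
  ultimately show ?thesis by (simp add: degree_in_def)
qed

lemma degree_in_mono: "finite B \<Longrightarrow> A \<subseteq> B \<Longrightarrow> degree_in A x \<le> degree_in B x"
  unfolding degree_in_def by (intro card_mono) auto

locale exposure = linear_space V \<L> n d
  for V :: "'a set" and \<L> :: "'a set set" and n d :: nat +
  fixes K r :: nat
  assumes n_eq: "n = (2 ^ (K + 10)) ^ K" and d_eq: "d = r ^ K"
    and r_ge: "4 \<le> r" and r_dvd: "4 dvd r"
begin

definition cap :: "nat \<Rightarrow> nat" where "cap j = r ^ (K - j)"
definition thr :: "nat \<Rightarrow> nat" where "thr j = (2 ^ (K + 10)) ^ (K - j)"

text \<open>Lines through \<open>y\<close> meet only in \<open>y\<close>; leaving \<open>y\<close>
  out makes the low-degree point sets of distinct fresh lines disjoint.\<close>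

definition fresh_lines :: "(nat \<Rightarrow> 'a set set) \<Rightarrow> nat \<Rightarrow> 'a \<Rightarrow> 'a set set" where
  "fresh_lines W j y = {l \<in> W j - W (Suc j). y \<in> l \<and>
     thr (Suc j) \<le> card {x \<in> l - {y}. degree_in (W (Suc j)) x < cap (Suc j)}}"

text \<open>
In a state \<open>W\<close>, the family \<open>W j\<close> consists of lines carrying at least \<open>j\<close> exposed points. Exposing \<open>y\<close>
promotes those lines through \<open>y\<close> that still contain many points of low degree in the next family;
this keeps \<open>card (W j)\<close> in proportion to the degree cap and bounds the total number of promotions.
\<close>

definition expose :: "'a \<Rightarrow> (nat \<Rightarrow> 'a set set) \<Rightarrow> nat \<Rightarrow> 'a set set" where
  "expose y W j = W j \<union> (case j of 0 \<Rightarrow> {} | Suc i \<Rightarrow> fresh_lines W i y)"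

definition \<Phi> :: "(nat \<Rightarrow> 'a set set) \<Rightarrow> nat \<Rightarrow> nat" where
  "\<Phi> W j = (\<Sum>x\<in>V. min (degree_in (W j) x) (cap j))"

text \<open>The weights balance the levels: each contributes at most \<open>card V * r ^ K\<close>,
  and \<open>cap j / 4\<close> promotions out of any level \<open>j < K\<close> raise the total by
  at least \<open>r ^ Suc K div 4\<close>.\<close>

definition \<Psi> :: "(nat \<Rightarrow> 'a set set) \<Rightarrow> nat" where
  "\<Psi> W = (\<Sum>j\<in>{1..K}. \<Phi> W j * r ^ j)"

text \<open>With \<open>\<Phi>_le\<close> the last clause gives
  \<open>card (W j) * thr j \<le> cap j * card V\<close>, the scarcity of lines on which the
  averaging in \<open>card_not_useful\<close> rests.\<close>

definition inv_state :: "(nat \<Rightarrow> 'a set set) \<Rightarrow> 'a set \<Rightarrow> bool" where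
  "inv_state W X \<longleftrightarrow> W 0 = \<L> \<and> (\<forall>j. W j \<subseteq> \<L> \<and> W (Suc j) \<subseteq> W j \<and>
     (\<forall>l\<in>W j. j \<le> card (l \<inter> X)) \<and> card (W j) * thr j \<le> \<Phi> W j)"

definition useful :: "(nat \<Rightarrow> 'a set set) \<Rightarrow> 'a \<Rightarrow> bool" where
  "useful W y \<longleftrightarrow> (\<exists>j<K. cap j \<le> 4 * card (fresh_lines W j y))"

lemma cap_Suc: "j < K \<Longrightarrow> cap j = r * cap (Suc j)"
  unfolding cap_def by (simp add: Suc_diff_Suc flip: power_Suc)

lemma thr_Suc: "j < K \<Longrightarrow> thr j = 2 ^ (K + 10) * thr (Suc j)"
  unfolding thr_def by (simp add: Suc_diff_Suc flip: power_Suc)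

section \<open>Invariant and potential under one exposure\<close>

lemma thr_pos: "0 < thr j"
  unfolding thr_def by simp

lemma cap_pos: "0 < cap j"
  unfolding cap_def using r_ge by simp

lemma \<Phi>_le: "\<Phi> W j \<le> cap j * card V"
proof -
  have "\<Phi> W j \<le> (\<Sum>x\<in>V. cap j)" unfolding \<Phi>_def by (intro sum_mono) simp
  then show ?thesis by (simp add: mult.commute)
qed

lemma \<Psi>_le: "\<Psi> W \<le> K * card V * r ^ K"
proof -
  have "\<Phi> W j * r ^ j \<le> card V * r ^ K" if "j \<in> {1..K}" for j
  proof -
    have "\<Phi> W j * r ^ j \<le> cap j * card V * r ^ j" using \<Phi>_le by simp
    also have "\<dots> = card V * (r ^ (K - j) * r ^ j)" by (simp add: cap_def)
    also have "r ^ (K - j) * r ^ j = r ^ K" using that by (simp flip: power_add)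
    finally show ?thesis .
  qed
  then have "\<Psi> W \<le> (\<Sum>j\<in>{1..K}. card V * r ^ K)" unfolding \<Psi>_def by (rule sum_mono)
  then show ?thesis by simp
qed

lemma inv_state_subset: "inv_state W X \<Longrightarrow> W j \<subseteq> \<L>"
  unfolding inv_state_def by auto

lemma inv_state_finite: "inv_state W X \<Longrightarrow> finite (W j)"
  by (rule finite_subset[OF inv_state_subset finite_lines])

lemma inv_state_init: "inv_state (\<lambda>j. if j = 0 then \<L> else {}) {}"
proof -
  have "card \<L> * n = (\<Sum>l\<in>\<L>. card (l \<inter> V))"
    using line_subset card_line by (simp add: Int_absorb2)
  also have "\<dots> = (\<Sum>x\<in>V. degree_in \<L> x)"
    using sum_degree_in finite_lines finite_V by metis
  also have "\<dots> = (\<Sum>x\<in>V. min (degree_in \<L> x) (cap 0))"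
    by (intro sum.cong) (auto simp: degree_in_def card_lines_through cap_def d_eq)
  finally have "card \<L> * thr 0 \<le> (\<Sum>x\<in>V. min (degree_in \<L> x) (cap 0))"
    by (simp add: thr_def n_eq)
  then show ?thesis unfolding inv_state_def \<Phi>_def by auto
qed

text \<open>Each fresh line carries at least \<open>thr (Suc j)\<close> points of degree below the
  cap. These sets are disjoint, and each of their points gains at least one in truncated
  degree.\<close>

lemma \<Phi>_expose:
  assumes "inv_state W X"
  shows "\<Phi> W (Suc j) + thr (Suc j) * card (fresh_lines W j y) \<le> \<Phi> (expose y W) (Suc j)"
proof -
  define F where "F = fresh_lines W j y"
  define G where "G l = {x \<in> l - {y}. degree_in (W (Suc j)) x < cap (Suc j)}" for l
  have F: "F \<subseteq> \<L>" "\<And>l. l \<in> F \<Longrightarrow> y \<in> l" "\<And>l. l \<in> F \<Longrightarrow> thr (Suc j) \<le> card (G l)" "F \<inter> W (Suc j) = {}"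
    unfolding F_def G_def fresh_lines_def using inv_state_subset[OF assms] by auto
  have finF: "finite F" using F finite_lines finite_subset by blast
  have disj: "\<forall>l\<in>F. \<forall>l'\<in>F. l \<noteq> l' \<longrightarrow> G l \<inter> G l' = {}"
  proof (intro ballI impI)
    fix l l' assume l: "l \<in> F" "l' \<in> F" "l \<noteq> l'"
    have "x = y" if "x \<in> l" "x \<in> l'" for x
      using lines_meet_once[of l l' x y] l that F(1,2) by blast
    then show "G l \<inter> G l' = {}" unfolding G_def by blast
  qed
  have finG: "\<forall>l\<in>F. finite (G l)" using F(1) finite_line unfolding G_def by auto
  define Y where "Y = (\<Union>l\<in>F. G l)"
  have YV: "Y \<subseteq> V" unfolding Y_def G_def using F(1) line_subset by auto
  have "thr (Suc j) * card F = (\<Sum>l\<in>F. thr (Suc j))" by simp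
  also have "\<dots> \<le> (\<Sum>l\<in>F. card (G l))" using F(3) by (rule sum_mono)
  also have "\<dots> = card Y" unfolding Y_def using card_UN_disjoint[OF finF finG disj] by simp
  also have "\<dots> = (\<Sum>x\<in>V. if x \<in> Y then 1 else 0)"
    using YV finite_V by (simp add: sum.If_cases Int_absorb1)
  finally have "\<Phi> W (Suc j) + thr (Suc j) * card F
      \<le> (\<Sum>x\<in>V. min (degree_in (W (Suc j)) x) (cap (Suc j)) + (if x \<in> Y then 1 else 0))"
    unfolding \<Phi>_def by (simp add: sum.distrib)
  also have "\<dots> \<le> (\<Sum>x\<in>V. min (degree_in (expose y W (Suc j)) x) (cap (Suc j)))"
  proof (rule sum_mono)
    fix x assume "x \<in> V"
    have fin: "finite (W (Suc j))" using inv_state_finite[OF assms] .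
    have ex: "expose y W (Suc j) = W (Suc j) \<union> F" by (simp add: expose_def F_def)
    have mono: "degree_in (W (Suc j)) x \<le> degree_in (W (Suc j) \<union> F) x"
      using fin finF by (intro degree_in_mono) auto
    show "min (degree_in (W (Suc j)) x) (cap (Suc j)) + (if x \<in> Y then 1 else 0)
        \<le> min (degree_in (expose y W (Suc j)) x) (cap (Suc j))"
    proof (cases "x \<in> Y")
      case True
      then obtain l where l: "l \<in> F" "x \<in> l" and lt: "degree_in (W (Suc j)) x < cap (Suc j)"
        unfolding Y_def G_def by auto
      have "l \<notin> W (Suc j)" using l(1) F(4) by auto
      then have "{l \<in> W (Suc j). x \<in> l} \<subset> {l \<in> W (Suc j) \<union> F. x \<in> l}" using l by auto
      then have "degree_in (W (Suc j)) x < degree_in (W (Suc j) \<union> F) x"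
        unfolding degree_in_def using fin finF by (intro psubset_card_mono) auto
      then show ?thesis using lt True ex by simp
    next
      case False
      then show ?thesis using mono ex by simp
    qed
  qed
  finally show ?thesis unfolding \<Phi>_def F_def .
qed

text \<open>A promoted line acquires the new point \<open>y\<close>, so its count rises with its
  level. The size clause survives because \<open>\<Phi>_expose\<close> pays \<open>thr j\<close> for
  every promoted line.\<close>

lemma inv_state_expose:
  assumes inv: "inv_state W X" and y: "y \<in> V" "y \<notin> X" and X: "X \<subseteq> V"
  shows "inv_state (expose y W) (insert y X)"
proof -
  have finX: "finite X" using X finite_V finite_subset by blast
  have W: "W 0 = \<L>" "\<And>j. W j \<subseteq> \<L>" "\<And>j. W (Suc j) \<subseteq> W j"
    "\<And>j l. l \<in> W j \<Longrightarrow> j \<le> card (l \<inter> X)" "\<And>j. card (W j) * thr j \<le> \<Phi> W j"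
    using inv unfolding inv_state_def by auto
  have sub: "expose y W (Suc j) \<subseteq> W j" for j
    using W(3) unfolding expose_def fresh_lines_def by auto
  have grow: "W j \<subseteq> expose y W j" for j unfolding expose_def by auto
  have E0: "expose y W 0 = W 0" by (simp add: expose_def)
  have le: "card (l \<inter> X) \<le> card (l \<inter> insert y X)" for l
    using finX by (intro card_mono) auto
  have 3: "j \<le> card (l \<inter> insert y X)" if lj: "l \<in> expose y W j" for j l
  proof (cases "l \<in> W j")
    case True
    then show ?thesis using W(4) le order_trans by blast
  next
    case False
    then obtain i where i: "j = Suc i" "l \<in> fresh_lines W i y"
      using lj unfolding expose_def by (cases j) auto
    then have l: "l \<in> W i" "y \<in> l" unfolding fresh_lines_def by auto
    then have "l \<inter> insert y X = insert y (l \<inter> X)" by auto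
    then have "card (l \<inter> insert y X) = Suc (card (l \<inter> X))" using finX y by simp
    then show ?thesis using W(4)[OF l(1)] i by simp
  qed
  have 4: "card (expose y W j) * thr j \<le> \<Phi> (expose y W) j" for j
  proof (cases j)
    case 0
    then show ?thesis using W(5)[of 0] E0 by (simp add: \<Phi>_def)
  next
    case (Suc i)
    have "card (expose y W j) \<le> card (W j) + card (fresh_lines W i y)"
      using Suc by (simp add: expose_def card_Un_le)
    then have "card (expose y W j) * thr j \<le> (card (W j) + card (fresh_lines W i y)) * thr j"
      by (rule mult_right_mono) simp
    also have "\<dots> \<le> \<Phi> W j + thr j * card (fresh_lines W i y)"
      using W(5)[of j] by (simp add: algebra_simps)
    also have "\<dots> \<le> \<Phi> (expose y W) j" using \<Phi>_expose[OF inv] Suc by simp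
    finally show ?thesis .
  qed
  have "expose y W j \<subseteq> \<L>" for j 
  proof (cases j)
    case 0
    then show ?thesis using E0 W(2) by simp
  next
    case (Suc i)
    then show ?thesis using sub[of i] W(2)[of i] by simp
  qed
  moreover have "expose y W (Suc j) \<subseteq> expose y W j" for j using sub grow by blast
  ultimately show ?thesis unfolding inv_state_def using 3 4 E0 W(1) by blast
qed

lemma \<Psi>_expose_mono:
  assumes inv: "inv_state W X"
  shows "\<Psi> W \<le> \<Psi> (expose y W)"
  unfolding \<Psi>_def
proof (intro sum_mono mult_right_mono)
  fix j assume "j \<in> {1..K}"
  then obtain i where "j = Suc i" by (cases j) auto
  then show "\<Phi> W j \<le> \<Phi> (expose y W) j" using \<Phi>_expose[OF inv, of i y] by simp
qed simp

text \<open>At the level witnessing usefulness, \<open>cap j * r ^ Suc j\<close> is exactly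
  \<open>r ^ Suc K\<close>; the other levels can only grow.\<close>

lemma \<Psi>_expose_useful:
  assumes inv: "inv_state W X" and u: "useful W y"
  shows "\<Psi> W + r ^ Suc K div 4 \<le> \<Psi> (expose y W)"
proof -
  obtain j where j: "j < K" "cap j \<le> 4 * card (fresh_lines W j y)"
    using u unfolding useful_def by auto
  have mono: "\<Phi> W i \<le> \<Phi> (expose y W) i" if "i \<in> {1..K}" for i
    using \<Phi>_expose[OF inv, of "i - 1" y] that by simp
  have "r ^ Suc K = cap j * r ^ Suc j"
    using j(1) by (simp add: cap_def flip: power_add)
  also have "\<dots> \<le> 4 * card (fresh_lines W j y) * r ^ Suc j"
    using j(2) by (rule mult_right_mono) simp
  also have "\<dots> \<le> 4 * (thr (Suc j) * card (fresh_lines W j y)) * r ^ Suc j"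
    using thr_pos[of "Suc j"] by (intro mult_right_mono) auto
  finally have "r ^ Suc K \<le> 4 * (thr (Suc j) * card (fresh_lines W j y) * r ^ Suc j)"
    by (simp only: mult.assoc)
  then have g: "r ^ Suc K div 4 \<le> thr (Suc j) * card (fresh_lines W j y) * r ^ Suc j"
    by linarith
  have "\<Psi> W + r ^ Suc K div 4 = \<Phi> W (Suc j) * r ^ Suc j + r ^ Suc K div 4 + (\<Sum>i\<in>{1..K}-{Suc j}. \<Phi> W i * r ^ i)"
    unfolding \<Psi>_def using j(1) by (subst sum.remove[of _ "Suc j"]) auto
  also have "\<dots> \<le> \<Phi> W (Suc j) * r ^ Suc j + thr (Suc j) * card (fresh_lines W j y) * r ^ Suc j
      + (\<Sum>i\<in>{1..K}-{Suc j}. \<Phi> (expose y W) i * r ^ i)"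
    using g mono by (intro add_mono sum_mono mult_right_mono) auto
  also have "\<dots> = (\<Phi> W (Suc j) + thr (Suc j) * card (fresh_lines W j y)) * r ^ Suc j
      + (\<Sum>i\<in>{1..K}-{Suc j}. \<Phi> (expose y W) i * r ^ i)" by (simp only: algebra_simps)
  also have "\<dots> \<le> \<Phi> (expose y W) (Suc j) * r ^ Suc j + (\<Sum>i\<in>{1..K}-{Suc j}. \<Phi> (expose y W) i * r ^ i)"
    using \<Phi>_expose[OF inv, of j y] by (intro add_mono mult_right_mono) auto
  also have "\<dots> = \<Psi> (expose y W)"
    unfolding \<Psi>_def using j(1) by (subst (2) sum.remove[of _ "Suc j"]) auto
  finally show ?thesis .
qed

text \<open>
If the useless points were dense, then for every \<open>j\<close> in turn a positive proportion of them would have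
full degree in \<open>W j\<close>: otherwise, by averaging, one of the deficient points would lie on many lines of
\<open>W j\<close> with many deficient points, and would be useful.
\<close>

lemma card_not_useful:
  assumes inv: "inv_state W X" and B: "B \<subseteq> V"
    and nu: "\<And>y. y \<in> B \<Longrightarrow> \<not> useful W y"
    and free: "\<And>y l. y \<in> B \<Longrightarrow> l \<in> W K \<Longrightarrow> y \<notin> l"
  shows "256 * card B \<le> card V"
proof (rule ccontr)
  assume "\<not> ?thesis"
  then have big: "card V < 256 * card B" by simp
  have finB: "finite B" using B finite_V finite_subset by blast
  have finW: "finite (W j)" for j using inv_state_finite[OF inv] .
  \<comment> \<open>Losing at most half of the points per level costs \<open>2 ^ K\<close> in all;
    the ratio \<open>2 ^ (K + 10)\<close> of consecutive thresholds absorbs this.\<close>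
  have "\<exists>C\<subseteq>B. card B \<le> 2 ^ j * card C \<and> (\<forall>y\<in>C. cap j \<le> degree_in (W j) y)" if "j \<le> K" for j
    using that
  proof (induction j)
    case 0
    have "degree_in (W 0) y = cap 0" if "y \<in> B" for y
      using inv that B card_lines_through d_eq unfolding inv_state_def degree_in_def cap_def by auto
    then show ?case by (intro exI[of _ B]) auto
  next
    case (Suc j)
    then obtain C where C: "C \<subseteq> B" "card B \<le> 2 ^ j * card C"
      "\<And>y. y \<in> C \<Longrightarrow> cap j \<le> degree_in (W j) y" by auto
    have jK: "j < K" using Suc by simp
    define C' where "C' = {y \<in> C. cap (Suc j) \<le> degree_in (W (Suc j)) y}"
    define E where "E = C - C'"
    have finC: "finite C" using C(1) finB finite_subset by blast
    have "card C \<le> 2 * card C'"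
    proof (rule ccontr)
      assume "\<not> ?thesis"
      moreover have "card C = card C' + card E"
        unfolding E_def using finC by (simp add: C'_def card_Diff_subset card_mono)
      ultimately have cE: "card C < 2 * card E" by simp
      have finE: "finite E" using finC E_def by simp
      have unsat: "degree_in (W (Suc j)) y < cap (Suc j)" if "y \<in> E" for y
        using that unfolding E_def C'_def by auto
      \<comment> \<open>Unpromoted lines are split by their number of deficient points. The strict
        \<open>h <\<close> in \<open>R'\<close> leaves \<open>thr (Suc j)\<close> of them after
        \<open>y\<close> is removed, so such lines are fresh.\<close>
      define h where "h = thr (Suc j)"
      define R where "R = {l \<in> W j - W (Suc j). card (l \<inter> E) \<le> h}"
      define R' where "R' = {l \<in> W j - W (Suc j). h < card (l \<inter> E)}"
      have RR: "degree_in (W j) y \<le> degree_in (W (Suc j)) y + degree_in R y + degree_in R' y" for y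
      proof -
        have "{l \<in> W j. y \<in> l} \<subseteq> {l \<in> W (Suc j). y \<in> l} \<union> {l \<in> R. y \<in> l} \<union> {l \<in> R'. y \<in> l}"
          unfolding R_def R'_def by auto
        then have "degree_in (W j) y \<le> card ({l \<in> W (Suc j). y \<in> l} \<union> {l \<in> R. y \<in> l} \<union> {l \<in> R'. y \<in> l})"
          unfolding degree_in_def using finW by (intro card_mono) (auto simp: R_def R'_def)
        also have "\<dots> \<le> degree_in (W (Suc j)) y + degree_in R y + degree_in R' y"
          unfolding degree_in_def by (meson add_le_mono1 card_Un_le order_trans)
        finally show ?thesis .
      qed
      have R'y: "4 * degree_in R' y < cap j" if "y \<in> E" for y
      proof -
        have "{l \<in> R'. y \<in> l} \<subseteq> fresh_lines W j y"
        proof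
          fix l assume "l \<in> {l \<in> R'. y \<in> l}"
          then have l: "l \<in> W j - W (Suc j)" "h < card (l \<inter> E)" "y \<in> l" unfolding R'_def by auto
          have finl: "finite l" using l(1) inv_state_subset[OF inv] finite_line by blast
          have "l \<inter> E - {y} \<subseteq> {x \<in> l - {y}. degree_in (W (Suc j)) x < cap (Suc j)}"
            using unsat by auto
          then have "card (l \<inter> E - {y}) \<le> card {x \<in> l - {y}. degree_in (W (Suc j)) x < cap (Suc j)}"
            using finl by (intro card_mono) auto
          moreover have "card (l \<inter> E - {y}) = card (l \<inter> E) - 1"
            using l(3) that finl by simp
          ultimately show "l \<in> fresh_lines W j y" unfolding fresh_lines_def using l h_def by auto
        qed
        then have "degree_in R' y \<le> card (fresh_lines W j y)"
          unfolding degree_in_def using finW by (intro card_mono) (auto simp: fresh_lines_def)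
        moreover have "4 * card (fresh_lines W j y) < cap j"
          using nu[of y] that C(1) jK unfolding useful_def E_def by (metis DiffD1 linorder_not_le subsetD)
        ultimately show ?thesis by linarith
      qed
      \<comment> \<open>\<open>W (Suc j)\<close> and \<open>R'\<close> each account for less than a
        quarter of \<open>cap j\<close>, so more than half of the degree comes from
        \<open>R\<close>, whose lines are too few and too poor to supply it.\<close>
      have half: "4 * cap (Suc j) \<le> cap j" using cap_Suc[OF jK] r_ge by simp
      have pt: "cap j < 2 * degree_in R y" if "y \<in> E" for y
      proof -
        have "cap j \<le> degree_in (W j) y" using C(3) that E_def by auto
        then show ?thesis using RR[of y] R'y[OF that] unsat[OF that] half by linarith
      qed
      have "card E * cap j = (\<Sum>y\<in>E. cap j)" by simp
      also have "\<dots> \<le> (\<Sum>y\<in>E. 2 * degree_in R y)" using pt by (intro sum_mono less_imp_le)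
      also have "\<dots> = 2 * (\<Sum>l\<in>R. card (l \<inter> E))"
        using sum_degree_in[of R E] finE finW by (simp add: R_def flip: sum_distrib_left)
      also have "(\<Sum>l\<in>R. card (l \<inter> E)) \<le> (\<Sum>l\<in>R. h)" by (intro sum_mono) (simp add: R_def)
      also have "(\<Sum>l\<in>R. h) \<le> card (W j) * h"
      proof -
        have "card R \<le> card (W j)" using finW by (intro card_mono) (auto simp: R_def)
        then show ?thesis by simp
      qed
      finally have "card E * cap j \<le> 2 * (card (W j) * h)" by simp
      then have "2 ^ (K + 10) * (card E * cap j) \<le> 2 ^ (K + 10) * (2 * (card (W j) * h))"
        by (rule mult_left_mono) simp
      also have "\<dots> = 2 * (card (W j) * thr j)" using thr_Suc[OF jK] h_def by simp
      also have "\<dots> \<le> 2 * (cap j * card V)"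
        using inv \<Phi>_le[of W j] unfolding inv_state_def by (meson mult_le_mono2 order_trans)
      finally have "cap j * (2 ^ (K + 10) * card E) \<le> cap j * (2 * card V)"
        by (simp add: algebra_simps)
      then have e: "2 ^ (K + 10) * card E \<le> 2 * card V" using cap_pos[of j] by simp
      have "card B \<le> 2 ^ j * (2 * card E)"
        using C(2) cE by (meson less_imp_le mult_le_mono2 order_trans)
      also have "\<dots> \<le> 2 ^ K * (2 * card E)" using jK by (intro mult_right_mono power_increasing) auto
      finally have "512 * card B \<le> 2 ^ (K + 10) * card E" by (simp add: power_add mult_ac)
      then show False using e big by linarith
    qed
    then have "card B \<le> 2 ^ Suc j * card C'" using C(2) 
      by (metis (no_types, lifting) mult.assoc mult_le_mono2 order_trans power_Suc2)
    then show ?case using C(1) by (intro exI[of _ C']) (auto simp: C'_def)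
  qed
  from this[of K] obtain C where C: "C \<subseteq> B" "card B \<le> 2 ^ K * card C"
      "\<And>y. y \<in> C \<Longrightarrow> cap K \<le> degree_in (W K) y" by auto
  \<comment> \<open>Since \<open>cap K\<close> is 1, a point of \<open>C\<close> lies on a line of
    \<open>W K\<close>, which \<open>free\<close> forbids.\<close>
  have "C \<noteq> {}" using C(2) big by auto
  then obtain y where y: "y \<in> C" by auto
  then have "{l \<in> W K. y \<in> l} = {}" using free C(1) by auto
  then have "degree_in (W K) y = 0" unfolding degree_in_def by (simp only: card.empty)
  then show False using C(3)[OF y] cap_pos[of K] by simp
qed

end

section \<open>Counting sequences without rich lines\<close>

text \<open>Index sets are coded as boolean lists so that sample and index set can be consumed
  together, one position at a time.\<close>

definition marked :: "bool list \<Rightarrow> 'a list \<Rightarrow> 'a set" where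
  "marked bs xs = {x. (True, x) \<in> set (zip bs xs)}"

lemma marked_Cons: "marked (b # bs) (x # xs) = (if b then insert x (marked bs xs) else marked bs xs)"
  unfolding marked_def by auto

lemma card_UN_mult_le:
  assumes "finite I" "card I \<le> c" "\<And>i. i \<in> I \<Longrightarrow> card (A i) * m \<le> (b::nat)"
  shows "card (\<Union>i\<in>I. A i) * m \<le> c * b"
proof -
  have "card (\<Union>i\<in>I. A i) * m \<le> (\<Sum>i\<in>I. card (A i)) * m"
    by (rule mult_right_mono[OF card_UN_le[OF assms(1)]]) simp
  also have "\<dots> = (\<Sum>i\<in>I. card (A i) * m)" by (simp add: sum_distrib_right)
  also have "\<dots> \<le> (\<Sum>i\<in>I. b)" using assms(3) by (rule sum_mono)
  also have "\<dots> \<le> c * b" using assms(2) by simp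
  finally show ?thesis .
qed

lemma card_subsets_le:
  assumes "finite S"
  shows "card {A. A \<subseteq> S \<and> card A = k} \<le> card S ^ k"
proof (cases "k \<le> card S")
  case True
  then show ?thesis using assms by (simp add: n_subsets binomial_le_pow)
next
  case False
  then show ?thesis using assms by (simp add: n_subsets binomial_eq_0)
qed

lemma card_lists_in:
  assumes "\<And>j. finite (F j)"
  shows "finite {xs. length xs = N \<and> (\<forall>j<N. xs ! j \<in> F j)}"
    and "card {xs. length xs = N \<and> (\<forall>j<N. xs ! j \<in> F j)} = (\<Prod>j<N. card (F j))"
proof -
  have "finite {xs. length xs = N \<and> (\<forall>j<N. xs ! j \<in> F j)} \<and>
      card {xs. length xs = N \<and> (\<forall>j<N. xs ! j \<in> F j)} = (\<Prod>j<N. card (F j))"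
  proof (induction N)
    case 0
    have "{xs. length xs = 0 \<and> (\<forall>j<0. xs ! j \<in> F j)} = {[]}" by auto
    then show ?case by simp
  next
    case (Suc N)
    let ?L = "\<lambda>N. {xs. length xs = N \<and> (\<forall>j<N. xs ! j \<in> F j)}"
    have eq: "?L (Suc N) = (\<lambda>(xs, x). xs @ [x]) ` (?L N \<times> F N)"
    proof (intro equalityI subsetI)
      fix ys assume ys: "ys \<in> ?L (Suc N)"
      then obtain xs x where x: "ys = xs @ [x]" by (cases ys rule: rev_cases) auto
      then have "length xs = N" using ys by auto
      moreover have "x \<in> F N" using ys x by (auto simp: nth_append)
      moreover have "xs ! j \<in> F j" if "j < N" for j
      proof -
        have "ys ! j \<in> F j" using ys that by auto
        then show ?thesis using x that \<open>length xs = N\<close> by (auto simp: nth_append)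
      qed
      ultimately show "ys \<in> (\<lambda>(xs, x). xs @ [x]) ` (?L N \<times> F N)" using x by auto
    qed (auto simp: nth_append less_Suc_eq)
    have inj: "inj_on (\<lambda>(xs, x). xs @ [x]) (?L N \<times> F N)" by (auto simp: inj_on_def)
    show ?case unfolding eq using Suc assms[of N]
      by (simp add: card_image[OF inj] card_cartesian_product)
  qed
  then show "finite {xs. length xs = N \<and> (\<forall>j<N. xs ! j \<in> F j)}"
    and "card {xs. length xs = N \<and> (\<forall>j<N. xs ! j \<in> F j)} = (\<Prod>j<N. card (F j))" by auto
qed

text \<open>Independence of the coordinates in counting form: powers of \<open>card V\<close> clear
  the denominators of the probabilities.\<close>

lemma card_lists_prescribed:
  assumes "finite V" "finite P" "finite Q" "i < N" "A \<subseteq> {..<N} - {i}" "A' \<subseteq> {..<N} - {i}" "A \<inter> A' = {}"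
  shows "card {xs. length xs = N \<and> (\<forall>j<N. xs ! j \<in> (if j = i then {x} else if j \<in> A then P
            else if j \<in> A' then Q else V))} * card V ^ Suc (card A + card A')
       = card P ^ card A * card Q ^ card A' * card V ^ N"
proof -
  define F where "F j = (if j = i then {x} else if j \<in> A then P else if j \<in> A' then Q else V)" for j
  have fin: "finite A" "finite A'" using assms(5,6) by (auto intro: finite_subset[of _ "{..<N} - {i}"])
  define R where "R = {..<N} - ({i} \<union> A \<union> A')"
  have split: "{..<N} = {i} \<union> (A \<union> (A' \<union> R))" using assms unfolding R_def by auto
  have "(\<Prod>j<N. card (F j)) = (\<Prod>j\<in>{i}. card (F j)) * ((\<Prod>j\<in>A. card (F j)) * ((\<Prod>j\<in>A'. card (F j)) * (\<Prod>j\<in>R. card (F j))))"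
    unfolding split using assms fin by (subst prod.union_disjoint | (auto simp: R_def)[1])+
  also have "(\<Prod>j\<in>{i}. card (F j)) = 1" by (simp add: F_def)
  also have "(\<Prod>j\<in>A. card (F j)) = (\<Prod>j\<in>A. card P)"
    using assms by (intro prod.cong) (auto simp: F_def)
  also have "(\<Prod>j\<in>A'. card (F j)) = (\<Prod>j\<in>A'. card Q)"
    using assms by (intro prod.cong) (auto simp: F_def)
  also have "(\<Prod>j\<in>R. card (F j)) = (\<Prod>j\<in>R. card V)"
    by (intro prod.cong) (auto simp: F_def R_def)
  finally have p: "(\<Prod>j<N. card (F j)) = card P ^ card A * card Q ^ card A' * card V ^ card R" by simp
  have "card {..<N} = card {i} + (card A + (card A' + card R))"
    unfolding split using assms fin by (subst card_Un_disjoint | (auto simp: R_def)[1])+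
  then have N: "N = card R + Suc (card A + card A')" by simp
  have "card {xs. length xs = N \<and> (\<forall>j<N. xs ! j \<in> F j)} = (\<Prod>j<N. card (F j))"
    using assms by (intro card_lists_in) (auto simp: F_def)
  then have "card {xs. length xs = N \<and> (\<forall>j<N. xs ! j \<in> F j)} * card V ^ Suc (card A + card A')
     = card P ^ card A * card Q ^ card A' * (card V ^ card R * card V ^ Suc (card A + card A'))"
    using p by simp
  also have "card V ^ card R * card V ^ Suc (card A + card A') = card V ^ N"
    using N by (metis power_add)
  finally show ?thesis unfolding F_def .
qed

section \<open>Counting sequences whose marked points stay sparse\<close>

context exposure begin

text \<open>\<open>X\<close> holds the points exposed earlier, which turns the count into a
  recursion on \<open>bs\<close>.\<close>

definition sparse_lists :: "'a set \<Rightarrow> bool list \<Rightarrow> 'a list set" where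
  "sparse_lists X bs = {xs. length xs = length bs \<and> set xs \<subseteq> V \<and>
     (\<forall>l\<in>\<L>. card (l \<inter> (X \<union> marked bs xs)) \<le> K)}"

lemma finite_sparse_lists: "finite (sparse_lists X bs)"
  by (rule finite_subset[OF _ finite_lists_length_eq[OF finite_V, of "length bs"]])
     (auto simp: sparse_lists_def)

lemma sparse_lists_False: "sparse_lists X (False # bs) = (\<lambda>(x, xs). x # xs) ` (V \<times> sparse_lists X bs)"
proof (intro equalityI subsetI)
  fix ys assume "ys \<in> sparse_lists X (False # bs)"
  then show "ys \<in> (\<lambda>(x, xs). x # xs) ` (V \<times> sparse_lists X bs)"
    unfolding sparse_lists_def by (cases ys) (auto simp: marked_Cons)
qed (auto simp: sparse_lists_def marked_Cons)

lemma sparse_lists_True: "sparse_lists X (True # bs) = (\<Union>x\<in>V. (#) x ` sparse_lists (insert x X) bs)"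
proof (intro equalityI subsetI)
  fix ys assume "ys \<in> sparse_lists X (True # bs)"
  then show "ys \<in> (\<Union>x\<in>V. (#) x ` sparse_lists (insert x X) bs)"
    unfolding sparse_lists_def by (cases ys) (auto simp: marked_Cons)
qed (auto simp: sparse_lists_def marked_Cons)

text \<open>\<open>e\<close> bounds the useful exposures that the potential still allows. A marked
  position saves a factor 64: a set \<open>Z\<close> of density at most 1/128 takes half of this
  allowance, useful points take the other half by using up one unit of \<open>e\<close>, and every
  other point overfills a line.\<close>

lemma card_sparse_lists:
  assumes "inv_state W X" "X \<subseteq> V" "256 * (card X + length bs) \<le> card V"
    and "K * card V * r ^ K \<le> \<Psi> W + r ^ Suc K div 4 * e"
  shows "card (sparse_lists X bs) * 64 ^ count_list bs True \<le> card V ^ length bs * 128 ^ e"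
  using assms
proof (induction bs arbitrary: W X e)
  case Nil
  have "sparse_lists X [] \<subseteq> {[]}" unfolding sparse_lists_def by auto
  from card_mono[OF _ this] have "card (sparse_lists X []) \<le> 1" by simp
  moreover have "(1::nat) \<le> 128 ^ e" by simp
  ultimately have "card (sparse_lists X []) \<le> 128 ^ e" by (rule order_trans)
  then show ?case by simp
next
  case (Cons b bs)
  show ?case
  proof (cases b)
    case False
    have "card (sparse_lists X (False # bs)) \<le> card V * card (sparse_lists X bs)"
      unfolding sparse_lists_False using finite_V finite_sparse_lists[of X bs]
      by (metis card_cartesian_product card_image_le finite_cartesian_product)
    then have "card (sparse_lists X (False # bs)) * 64 ^ count_list bs True
        \<le> card V * (card (sparse_lists X bs) * 64 ^ count_list bs True)"
      by (metis mult.assoc mult_right_mono zero_le)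
    also have "\<dots> \<le> card V * (card V ^ length bs * 128 ^ e)"
      using Cons.IH[OF Cons.prems(1,2) _ Cons.prems(4)] Cons.prems(3) by (intro mult_left_mono) auto
    finally show ?thesis using False by (simp add: mult_ac)
  next
    case True
    define R :: nat where "R = card V ^ length bs * 128 ^ e"
    define a where "a x = card (sparse_lists (insert x X) bs) * 64 ^ count_list bs True" for x
    define B where "B = {y \<in> V - X. \<not> useful W y \<and> (\<forall>l\<in>W K. y \<notin> l)}"
    \<comment> \<open>\<open>X\<close> and \<open>B\<close> each have density at most 1/256, by the
      length hypothesis and by \<open>card_not_useful\<close>.\<close>
    define Z where "Z = X \<union> B"
    have finX: "finite X" using Cons.prems(2) finite_V finite_subset by blast
    have "256 * card B \<le> card V"
      using Cons.prems(1) by (rule card_not_useful) (auto simp: B_def)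
    moreover have "card Z \<le> card X + card B" unfolding Z_def by (rule card_Un_le)
    moreover have "256 * card X \<le> card V" using Cons.prems(3) by simp
    ultimately have Z: "128 * card Z \<le> card V" by linarith
    have finZ: "finite Z" using finX finite_V by (auto simp: Z_def B_def)
    have ZV: "Z \<subseteq> V" using Cons.prems(2) by (auto simp: Z_def B_def)
    have step: "inv_state (expose x W) (insert x X)" "insert x X \<subseteq> V"
      "256 * (card (insert x X) + length bs) \<le> card V" if "x \<in> V - X" for x
      using inv_state_expose[of W X x] that Cons.prems finX by auto
    have inZ: "a x \<le> R" if "x \<in> Z" for x
    proof (cases "x \<in> X")
      case True
      then have "insert x X = X" by auto
      then show ?thesis unfolding a_def R_def
        using Cons.IH[OF Cons.prems(1,2) _ Cons.prems(4)] Cons.prems(3) by auto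
    next
      case False
      then have x: "x \<in> V - X" using that ZV by auto
      have "K * card V * r ^ K \<le> \<Psi> (expose x W) + r ^ Suc K div 4 * e"
        using Cons.prems(4) \<Psi>_expose_mono[OF Cons.prems(1), of x] by linarith
      then show ?thesis unfolding a_def R_def using Cons.IH[OF step[OF x]] by blast
    qed
    have outZ: "128 * a x \<le> R" if xZ: "x \<in> V - Z" for x
    proof (cases "useful W x")
      case True
      have x: "x \<in> V - X" using that unfolding Z_def by auto
      have up: "\<Psi> W + r ^ Suc K div 4 \<le> \<Psi> (expose x W)"
        by (rule \<Psi>_expose_useful[OF Cons.prems(1) True])
      have "1 \<le> r ^ K" using r_ge by simp
      then have "4 * 1 \<le> r * r ^ K" using r_ge by (intro mult_mono) auto
      then have pos: "0 < r ^ Suc K div 4" by simp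
      \<comment> \<open>With \<open>e = 0\<close> a further gain would push \<open>\<Psi>\<close>
        above its upper bound.\<close>
      obtain e' where e': "e = Suc e'"
      proof (cases e)
        case 0
        then show ?thesis using up pos Cons.prems(4) \<Psi>_le[of "expose x W"] by simp
      qed
      have "K * card V * r ^ K \<le> \<Psi> (expose x W) + r ^ Suc K div 4 * e'"
        using Cons.prems(4) up e' by simp
      then have "a x \<le> card V ^ length bs * 128 ^ e'"
        unfolding a_def using Cons.IH[OF step[OF x]] by blast
      then show ?thesis unfolding R_def e' by simp
    next
      case False
      then obtain l where l: "l \<in> W K" "x \<in> l" and x: "x \<in> V - X"
        using xZ unfolding Z_def B_def by auto
      \<comment> \<open>\<open>l\<close> already carries \<open>K\<close> exposed points, so
        \<open>x\<close> is one too many and no continuation is sparse.\<close>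
      have lL: "l \<in> \<L>" using l(1) inv_state_subset[OF Cons.prems(1)] by auto
      have "l \<inter> insert x X = insert x (l \<inter> X)" using l by auto
      then have "card (l \<inter> insert x X) = Suc (card (l \<inter> X))" using finX x by simp
      moreover have "K \<le> card (l \<inter> X)" using Cons.prems(1) l(1) unfolding inv_state_def by auto
      ultimately have c: "K < card (l \<inter> insert x X)" by simp
      have "sparse_lists (insert x X) bs = {}"
      proof (rule ccontr)
        assume "sparse_lists (insert x X) bs \<noteq> {}"
        then obtain xs where "card (l \<inter> (insert x X \<union> marked bs xs)) \<le> K"
          using lL unfolding sparse_lists_def by auto
        moreover have "card (l \<inter> insert x X) \<le> card (l \<inter> (insert x X \<union> marked bs xs))"
          using finite_line[OF lL] by (intro card_mono) auto
        ultimately show False using c by simp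
      qed
      then show ?thesis unfolding a_def by simp
    qed
    have "card (sparse_lists X (True # bs)) \<le> (\<Sum>x\<in>V. card ((#) x ` sparse_lists (insert x X) bs))"
      unfolding sparse_lists_True by (rule card_UN_le[OF finite_V])
    also have "\<dots> \<le> (\<Sum>x\<in>V. card (sparse_lists (insert x X) bs))"
      by (intro sum_mono card_image_le finite_sparse_lists)
    finally have "card (sparse_lists X (True # bs)) * 64 ^ count_list bs True \<le> (\<Sum>x\<in>V. a x)"
      unfolding a_def by (simp flip: sum_distrib_right)
    also have "(\<Sum>x\<in>V. a x) = (\<Sum>x\<in>Z. a x) + (\<Sum>x\<in>V - Z. a x)"
      using ZV finite_V by (metis add.commute sum.subset_diff)
    finally have "128 * (card (sparse_lists X (True # bs)) * 64 ^ count_list bs True)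
        \<le> 128 * (\<Sum>x\<in>Z. a x) + (\<Sum>x\<in>V - Z. 128 * a x)" by (simp flip: sum_distrib_left)
    also have "(\<Sum>x\<in>Z. a x) \<le> (\<Sum>x\<in>Z. R)" using inZ by (rule sum_mono)
    also have "(\<Sum>x\<in>V - Z. 128 * a x) \<le> (\<Sum>x\<in>V - Z. R)" using outZ by (rule sum_mono)
    also have "128 * (\<Sum>x\<in>Z. R) + (\<Sum>x\<in>V - Z. R) \<le> 128 * card Z * R + card V * R"
      using finite_V by (simp add: card_mono)
    also have "\<dots> \<le> card V * R + card V * R" using Z by (intro add_mono mult_right_mono) auto
    finally have "64 * (card (sparse_lists X (True # bs)) * 64 ^ count_list bs True) \<le> card V * R"
      by simp
    then show ?thesis using True by (simp add: R_def mult_ac)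
  qed
qed

end

section \<open>Random sampling\<close>

text \<open>The sample size \<open>N\<close> is \<open>64 * (K + 1) / r\<close> times
  \<open>card V\<close>; so \<open>q\<close> cancels from all probabilities at a fixed index, and
  \<open>r_large\<close> makes them small.\<close>

locale sampling = exposure V \<L> n d K r
  for V :: "'a set" and \<L> :: "'a set set" and n d K r :: nat +
  fixes q :: nat
  assumes card_V: "card V = q * r" and r_large: "300 * (64 * (K + 1) * n) ^ (2 * (K + 1)) \<le> r"
begin

abbreviation "N \<equiv> 64 * (K + 1) * q"

definition "samples = {xs. set xs \<subseteq> V \<and> length xs = N}"

text \<open>
An index \<open>i\<close> is discarded if its point is repeated, if \<open>K + 1\<close> further points share a line with it, or if
it lies on a line with \<open>K + 1\<close> sample points that crosses another such line; the last case keeps points outside the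
final set from blocking two lines at once.
\<close>

definition coincident :: "nat \<Rightarrow> 'a list set" where
  "coincident i = {xs \<in> samples. \<exists>j\<in>{..<N} - {i}. xs ! j = xs ! i}"

definition crowded :: "nat \<Rightarrow> 'a list set" where
  "crowded i = {xs \<in> samples. \<exists>l\<in>\<L>. xs ! i \<in> l \<and> (\<exists>A\<subseteq>{..<N} - {i}. card A = Suc K \<and> (\<forall>j\<in>A. xs ! j \<in> l))}"

definition crossed :: "nat \<Rightarrow> 'a list set" where
  "crossed i = {xs \<in> samples. \<exists>l\<in>\<L>. \<exists>l'\<in>\<L>. xs ! i \<in> l \<and> l \<inter> l' \<noteq> {} \<and>
     (\<exists>A\<subseteq>{..<N} - {i}. \<exists>A'\<subseteq>{..<N} - {i}. A \<inter> A' = {} \<and> card A = K \<and> card A' = Suc K \<and>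
       (\<forall>j\<in>A. xs ! j \<in> l) \<and> (\<forall>j\<in>A'. xs ! j \<in> l'))}"

section \<open>Probabilities of the three defects at a fixed index\<close>

lemma n_pos: "0 < n" using n_eq by simp

lemma q_pos: "0 < q"
  using card_V V_nonempty finite_V by (metis card_gt_0_iff mult_is_0 not_gr_zero)

lemma N_pos: "0 < N" using q_pos by simp

lemma finite_samples: "finite samples"
  unfolding samples_def by (rule finite_lists_length_eq[OF finite_V])

lemma card_samples: "card samples = card V ^ N"
  unfolding samples_def by (rule card_lists_length_eq[OF finite_V])

lemma r_large':
  assumes "m \<le> 2 * (K + 1)" 
  shows "60 * (64 * (K + 1) * n) ^ m \<le> r"
proof -
  have "(64 * (K + 1) * n) ^ m \<le> (64 * (K + 1) * n) ^ (2 * (K + 1))"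
    using assms n_pos by (intro power_increasing) auto
  then show ?thesis using r_large by linarith
qed

lemma r_ge_N: "256 * (64 * (K + 1)) \<le> r"
proof -
  have "(64 * (K + 1)) ^ 1 \<le> (64 * (K + 1) * n) ^ 1" using n_pos by simp
  also have "\<dots> \<le> (64 * (K + 1) * n) ^ (2 * (K + 1))" using n_pos by (intro power_increasing) auto
  finally have "64 * (K + 1) \<le> (64 * (K + 1) * n) ^ (2 * (K + 1))" by (simp only: power_one_right)
  then have "300 * (64 * (K + 1)) \<le> r" using r_large by (meson le_trans mult_le_mono2)
  then show ?thesis by linarith
qed

lemma card_others: "card ({..<N} - {i}) \<le> N"
  using card_Diff1_le[of "{..<N}" i] by simp

lemma N_le: "256 * N \<le> card V"
  using mult_right_mono[OF r_ge_N, of q] card_V by (simp add: mult_ac)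

lemma samples_prescribed:
  assumes "i < N" "A \<subseteq> {..<N} - {i}" "A' \<subseteq> {..<N} - {i}" "A \<inter> A' = {}" "finite P" "finite Q"
    and "card P \<le> p" "card Q \<le> p"
  shows "card {xs. length xs = N \<and> (\<forall>j<N. xs ! j \<in> (if j = i then {x} else if j \<in> A then P
            else if j \<in> A' then Q else V))} * card V ^ Suc (card A + card A')
       \<le> p ^ (card A + card A') * card V ^ N"
proof -
  have "card P ^ card A * card Q ^ card A' \<le> p ^ card A * p ^ card A'"
    using assms by (intro mult_mono power_mono) auto
  then show ?thesis
    using card_lists_prescribed[OF finite_V assms(5,6,1,2,3,4)] by (simp add: power_add mult_right_mono)
qed

text \<open>A union bound over the other index gives probability at most
  \<open>N / card V\<close>.\<close>

lemma card_coincident: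
  assumes "i < N"
  shows "60 * card (coincident i) \<le> card V ^ N"
proof -
  let ?C = "\<lambda>x j. {xs. length xs = N \<and> (\<forall>m<N. xs ! m \<in> (if m = i then {x} else if m \<in> {j} then {x}
            else if m \<in> {} then {x} else V))}"
  have sub: "coincident i \<subseteq> (\<Union>x\<in>V. \<Union>j\<in>{..<N} - {i}. ?C x j)"
  proof
    fix xs assume "xs \<in> coincident i"
    then obtain j where j: "j \<in> {..<N} - {i}" "xs ! j = xs ! i" "set xs \<subseteq> V" "length xs = N"
      unfolding coincident_def samples_def by auto
    then have "xs \<in> ?C (xs ! i) j" using assms by (auto simp: subset_iff)
    moreover have "xs ! i \<in> V" using j assms by (auto simp: subset_iff)
    ultimately show "xs \<in> (\<Union>x\<in>V. \<Union>j\<in>{..<N} - {i}. ?C x j)" using j(1) by blast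
  qed
  have fin: "finite (?C x j)" for x j
    by (rule card_lists_in(1)) (auto simp: finite_V)
  have "card (coincident i) \<le> card (\<Union>x\<in>V. \<Union>j\<in>{..<N} - {i}. ?C x j)"
    using sub fin finite_V by (intro card_mono finite_UN_I) auto
  then have "card (coincident i) * card V ^ 2 \<le> card (\<Union>x\<in>V. \<Union>j\<in>{..<N} - {i}. ?C x j) * card V ^ 2"
    by simp
  also have "\<dots> \<le> card V * (N * (card V ^ N))"
  proof (intro card_UN_mult_le)
    fix x j assume "j \<in> {..<N} - {i}"
    then show "card (?C x j) * card V ^ 2 \<le> card V ^ N"
      using samples_prescribed[of i "{j}" "{}" "{x}" "{x}" 1 x] assms by (simp add: power2_eq_square)
  qed (use finite_V card_others in auto)
  finally have "card V * (card V * card (coincident i)) \<le> card V * (N * card V ^ N)"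
    by (simp add: power2_eq_square mult_ac)
  then have "card V * card (coincident i) \<le> N * card V ^ N"
    using V_nonempty finite_V by (simp add: card_gt_0_iff)
  moreover have "60 * N * card (coincident i) \<le> card V * card (coincident i)"
    using N_le by (intro mult_right_mono) auto
  ultimately have "60 * N * card (coincident i) \<le> N * card V ^ N" by (rule order_trans[rotated])
  then have "N * (60 * card (coincident i)) \<le> N * card V ^ N" by (simp only: mult_ac)
  then show ?thesis using N_pos by (metis mult_le_cancel1)
qed

lemma card_lines_through_le: "x \<in> V \<Longrightarrow> card {l \<in> \<L>. x \<in> l} \<le> d"
  using card_lines_through by simp

lemma card_index_sets_le: "i < N \<Longrightarrow> card {A. A \<subseteq> {..<N} - {i} \<and> card A = m} \<le> N ^ m"
proof -
  assume "i < N"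
  have "card {A. A \<subseteq> {..<N} - {i} \<and> card A = m} \<le> card ({..<N} - {i}) ^ m"
    by (rule card_subsets_le) simp
  also have "\<dots> \<le> N ^ m" by (intro power_mono card_others) simp
  finally show ?thesis .
qed

text \<open>Union bound over the \<open>d\<close> lines through the point and at most
  \<open>N ^ Suc K\<close> index sets. In \<open>d * (N * n) ^ Suc K / card V ^ Suc K\<close> all of
  \<open>q\<close> and all but one factor \<open>r\<close> cancel, leaving
  \<open>(64 * (K + 1) * n) ^ Suc K / r\<close>.\<close>

lemma card_crowded:
  assumes "i < N"
  shows "60 * card (crowded i) \<le> card V ^ N"
proof -
  let ?C = "\<lambda>x l A. {xs. length xs = N \<and> (\<forall>m<N. xs ! m \<in> (if m = i then {x} else if m \<in> A then l
            else if m \<in> {} then l else V))}"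
  let ?A = "{A. A \<subseteq> {..<N} - {i} \<and> card A = Suc K}"
  have sub: "crowded i \<subseteq> (\<Union>x\<in>V. \<Union>l\<in>{l \<in> \<L>. x \<in> l}. \<Union>A\<in>?A. ?C x l A)"
  proof
    fix xs assume "xs \<in> crowded i"
    then obtain l A where h: "l \<in> \<L>" "xs ! i \<in> l" "A \<in> ?A" "\<forall>j\<in>A. xs ! j \<in> l" "set xs \<subseteq> V" "length xs = N"
      unfolding crowded_def samples_def by auto
    then have "xs \<in> ?C (xs ! i) l A" using assms by (auto simp: subset_iff)
    moreover have "xs ! i \<in> V" using h assms by (auto simp: subset_iff)
    ultimately show "xs \<in> (\<Union>x\<in>V. \<Union>l\<in>{l \<in> \<L>. x \<in> l}. \<Union>A\<in>?A. ?C x l A)" using h(1,2,3) by blast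
  qed
  have fin: "finite (?C x l A)" if "l \<in> \<L>" for x l A
    by (rule card_lists_in(1)) (use finite_V finite_line that in auto)
  have "card (crowded i) \<le> card (\<Union>x\<in>V. \<Union>l\<in>{l \<in> \<L>. x \<in> l}. \<Union>A\<in>?A. ?C x l A)"
    using sub fin finite_V finite_lines by (intro card_mono finite_UN_I) auto
  then have "card (crowded i) * card V ^ Suc (Suc K)
      \<le> card (\<Union>x\<in>V. \<Union>l\<in>{l \<in> \<L>. x \<in> l}. \<Union>A\<in>?A. ?C x l A) * card V ^ Suc (Suc K)"
    by (rule mult_right_mono) simp
  also have "\<dots> \<le> card V * (d * (N ^ Suc K * (n ^ Suc K * card V ^ N)))"
  proof (intro card_UN_mult_le card_index_sets_le card_lines_through_le)
    fix x l A assume h: "x \<in> V" "l \<in> {l \<in> \<L>. x \<in> l}" "A \<in> ?A"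
    show "card (?C x l A) * card V ^ Suc (Suc K) \<le> n ^ Suc K * card V ^ N"
      using samples_prescribed[of i A "{}" l l n x] assms h card_line finite_line by auto
  qed (use finite_V finite_lines assms in auto)
  finally have "card V * (card V ^ Suc K * card (crowded i)) \<le> card V * (d * (N ^ Suc K * (n ^ Suc K * card V ^ N)))"
    by (simp add: mult_ac)
  then have 1: "card V ^ Suc K * card (crowded i) \<le> d * (N * n) ^ Suc K * card V ^ N"
    using V_nonempty finite_V by (simp add: card_gt_0_iff power_mult_distrib mult_ac)
  have "60 * (d * (N * n) ^ Suc K) = r ^ K * q ^ Suc K * (60 * (64 * (K + 1) * n) ^ Suc K)"
    by (simp add: d_eq power_mult_distrib mult_ac)
  also have "\<dots> \<le> r ^ K * q ^ Suc K * r" using r_large'[of "Suc K"] by (intro mult_left_mono) auto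
  also have "\<dots> = card V ^ Suc K" by (simp add: card_V power_mult_distrib mult_ac)
  finally have 2: "60 * (d * (N * n) ^ Suc K) \<le> card V ^ Suc K" .
  have "card V ^ Suc K * (60 * card (crowded i)) = 60 * (card V ^ Suc K * card (crowded i))" by (simp only: mult_ac)
  also have "\<dots> \<le> 60 * (d * (N * n) ^ Suc K * card V ^ N)" using 1 by (rule mult_left_mono) simp
  also have "\<dots> = (60 * (d * (N * n) ^ Suc K)) * card V ^ N" by (simp only: mult_ac)
  also have "\<dots> \<le> card V ^ Suc K * card V ^ N" using 2 by (rule mult_right_mono) simp
  finally show ?thesis using V_nonempty finite_V
    by (metis card_gt_0_iff mult_le_cancel1 zero_less_power)
qed

text \<open>Besides \<open>l\<close> one chooses a crossing point \<open>v\<close> in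
  \<open>n\<close> ways and \<open>l'\<close> through \<open>v\<close> in \<open>d\<close> ways. The
  cost \<open>d * d * n\<close> is met by \<open>2 * K + 1\<close> prescribed indices, so again one
  factor \<open>r\<close> stays in the denominator.\<close>

lemma card_crossed:
  assumes "i < N"
  shows "60 * card (crossed i) \<le> card V ^ N"
proof -
  let ?C = "\<lambda>x l l' A A'. {xs. length xs = N \<and> (\<forall>m<N. xs ! m \<in> (if m = i then {x} else if m \<in> A then l
            else if m \<in> A' then l' else V))}"
  let ?A = "\<lambda>k. {A. A \<subseteq> {..<N} - {i} \<and> card A = k}"
  let ?A' = "\<lambda>A. {A'. A' \<subseteq> {..<N} - {i} \<and> card A' = Suc K \<and> A \<inter> A' = {}}"
  let ?U = "\<Union>x\<in>V. \<Union>l\<in>{l \<in> \<L>. x \<in> l}. \<Union>v\<in>l. \<Union>l'\<in>{l \<in> \<L>. v \<in> l}. \<Union>A\<in>?A K. \<Union>A'\<in>?A' A. ?C x l l' A A'"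
  have sub: "crossed i \<subseteq> ?U"
  proof
    fix xs assume "xs \<in> crossed i"
    then obtain l l' A A' where h: "l \<in> \<L>" "xs ! i \<in> l" "l' \<in> \<L>" "A \<subseteq> {..<N} - {i}" "card A = K"
        "A' \<subseteq> {..<N} - {i}" "card A' = Suc K" "A \<inter> A' = {}" "\<forall>j\<in>A. xs ! j \<in> l" "\<forall>j\<in>A'. xs ! j \<in> l'"
        and xs: "set xs \<subseteq> V" "length xs = N" and "l \<inter> l' \<noteq> {}"
      unfolding crossed_def samples_def by blast
    then obtain v where v: "v \<in> l" "v \<in> l'" by auto
    have C: "xs \<in> ?C (xs ! i) l l' A A'" using xs h(9,10) assms by (auto simp: subset_iff)
    have x: "xs ! i \<in> V" using xs assms by (auto simp: subset_iff)
    have l: "l \<in> {l \<in> \<L>. xs ! i \<in> l}" and l': "l' \<in> {l \<in> \<L>. v \<in> l}" using h(1-3) v by auto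
    have A: "A \<in> ?A K" and A': "A' \<in> ?A' A" using h by auto
    show "xs \<in> ?U"
      by (rule UN_I, rule x, rule UN_I, rule l, rule UN_I, rule v(1), rule UN_I, rule l',
          rule UN_I, rule A, rule UN_I, rule A', rule C)
  qed
  have finA': "finite (?A' A)" for A by (rule finite_subset[of _ "Pow {..<N}"]) auto
  have finA: "finite (?A k)" for k by (rule finite_subset[of _ "Pow {..<N}"]) auto
  have finU: "finite ?U"
  proof (rule finite_subset[OF _ finite_samples], rule subsetI)
    fix xs assume "xs \<in> ?U"
    then show "xs \<in> samples"
    proof (elim UN_E)
      fix x l v l' A A'
      assume h: "x \<in> V" "l \<in> {l \<in> \<L>. x \<in> l}" "l' \<in> {l \<in> \<L>. v \<in> l}" "xs \<in> ?C x l l' A A'"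
      then have "(if j = i then {x} else if j \<in> A then l else if j \<in> A' then l' else V) \<subseteq> V" for j
        using line_subset[of l] line_subset[of l'] by simp
      then show "xs \<in> samples" using h(4) unfolding samples_def by (fastforce simp: in_set_conv_nth)
    qed
  qed
  have "card (crossed i) \<le> card ?U"
    using sub finU by (rule card_mono[rotated])
  then have "card (crossed i) * card V ^ (2 * Suc K) \<le> card ?U * card V ^ (2 * Suc K)"
    by (rule mult_right_mono) simp
  also have "\<dots> \<le> card V * (d * (n * (d * (N ^ K * (N ^ Suc K * (n ^ (2 * K + 1) * card V ^ N))))))"
  proof (intro card_UN_mult_le card_index_sets_le card_lines_through_le finA finA')
    fix x l v l' A A' assume h: "x \<in> V" "l \<in> {l \<in> \<L>. x \<in> l}" "v \<in> l" "l' \<in> {l \<in> \<L>. v \<in> l}" "A \<in> ?A K" "A' \<in> ?A' A"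
    show "card (?C x l l' A A') * card V ^ (2 * Suc K) \<le> n ^ (2 * K + 1) * card V ^ N"
      using samples_prescribed[of i A A' l l' n x] assms h card_line finite_line
      by (auto simp: mult_2)
  next
    fix A
    have "card (?A' A) \<le> card (?A (Suc K))" using finA by (intro card_mono) auto
    then show "card (?A' A) \<le> N ^ Suc K" using card_index_sets_le[OF assms] order_trans by blast
  qed (use finite_V finite_lines finite_line card_line line_subset assms in auto)
  finally have "card V * (card V ^ (2 * K + 1) * card (crossed i))
      \<le> card V * (d * (n * (d * (N ^ K * (N ^ Suc K * (n ^ (2 * K + 1) * card V ^ N))))))"
    by (simp add: mult_ac)
  then have "card V ^ (2 * K + 1) * card (crossed i)
      \<le> d * (n * (d * (N ^ K * (N ^ Suc K * (n ^ (2 * K + 1) * card V ^ N)))))"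
    using V_nonempty finite_V by (metis card_gt_0_iff mult_le_cancel1)
  also have "\<dots> = (d * d * n * ((N ^ K * N ^ Suc K) * n ^ (2 * K + 1))) * card V ^ N"
    by (simp only: mult_ac)
  also have "N ^ K * N ^ Suc K = N ^ (2 * K + 1)"
    unfolding power_add[symmetric] by (rule arg_cong) simp
  finally have 1: "card V ^ (2 * K + 1) * card (crossed i) \<le> (d * d * n * (N * n) ^ (2 * K + 1)) * card V ^ N"
    by (simp only: power_mult_distrib)
  have "60 * (d * d * n * (N * n) ^ (2 * K + 1)) = (r ^ (2 * K) * q ^ (2 * K + 1)) * (60 * n * (64 * (K + 1) * n) ^ (2 * K + 1))"
  proof -
    have dd: "d * d = r ^ (2 * K)" by (simp only: d_eq mult_2 power_add)
    have Nn: "N * n = q * (64 * (K + 1) * n)" by (simp only: mult_ac)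
    show ?thesis unfolding dd Nn power_mult_distrib[of q] by (simp only: mult_ac)
  qed
  also have "\<dots> \<le> (r ^ (2 * K) * q ^ (2 * K + 1)) * r"
  proof (intro mult_left_mono)
    have "60 * n * (64 * (K + 1) * n) ^ (2 * K + 1) \<le> 60 * (64 * (K + 1) * n) * (64 * (K + 1) * n) ^ (2 * K + 1)"
      by (intro mult_right_mono) auto
    also have "\<dots> = 60 * (64 * (K + 1) * n) ^ (2 * (K + 1))" by simp
    also have "\<dots> \<le> r" by (rule r_large') simp
    finally show "60 * n * (64 * (K + 1) * n) ^ (2 * K + 1) \<le> r" .
  qed simp
  also have "\<dots> = card V ^ (2 * K + 1)" by (simp add: card_V power_mult_distrib mult_ac)
  finally have 2: "60 * (d * d * n * (N * n) ^ (2 * K + 1)) \<le> card V ^ (2 * K + 1)" .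
  have "card V ^ (2 * K + 1) * (60 * card (crossed i)) = 60 * (card V ^ (2 * K + 1) * card (crossed i))" by (simp only: mult_ac)
  also have "\<dots> \<le> 60 * ((d * d * n * (N * n) ^ (2 * K + 1)) * card V ^ N)" using 1 by (rule mult_left_mono) simp
  also have "\<dots> = (60 * (d * d * n * (N * n) ^ (2 * K + 1))) * card V ^ N" by (simp only: mult_ac)
  also have "\<dots> \<le> card V ^ (2 * K + 1) * card V ^ N" using 2 by (rule mult_right_mono) simp
  finally show ?thesis using V_nonempty finite_V
    by (metis card_gt_0_iff mult_le_cancel1 zero_less_power)
qed

section \<open>Union bound over index sets and a good sample\<close>

definition dense_sparse :: "'a list set" where
  "dense_sparse = (\<Union>bs\<in>{bs. set bs \<subseteq> UNIV \<and> length bs = N \<and> N \<le> 3 * count_list bs True}. sparse_lists {} bs)"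

text \<open>There are at most \<open>2 ^ N\<close> index sets, each of probability at most
  \<open>128 ^ (4 * K * q) / 4 ^ N\<close>, because \<open>64 ^ (N / 3) = 4 ^ N\<close>. The choice
  of \<open>N\<close> beats the remaining \<open>2 ^ (28 * K * q)\<close> with a factor 4 to
  spare.\<close>

lemma card_dense_sparse: "4 * card dense_sparse \<le> card V ^ N"
proof -
  let ?B = "{bs::bool list. set bs \<subseteq> UNIV \<and> length bs = N \<and> N \<le> 3 * count_list bs True}"
  have sub: "?B \<subseteq> {bs. set bs \<subseteq> UNIV \<and> length bs = N}" by auto
  have finB: "finite {bs::bool list. set bs \<subseteq> UNIV \<and> length bs = N}"
    by (rule finite_lists_length_eq) simp
  have cB: "card ?B \<le> 2 ^ N"
    using card_mono[OF finB sub] card_lists_length_eq[of "UNIV::bool set" N] by simp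
  have one: "card (sparse_lists {} bs) * 4 ^ N \<le> card V ^ N * 128 ^ (4 * K * q)" if "bs \<in> ?B" for bs
  proof -
    \<comment> \<open>The initial budget of useful exposures is the upper bound of
      \<open>\<Psi>\<close> divided by the gain of one exposure.\<close>
    have eq: "K * card V * r ^ K = r ^ Suc K div 4 * (4 * K * q)"
    proof -
      obtain r' where "r = 4 * r'" using r_dvd by auto
      then show ?thesis by (simp add: card_V)
    qed
    have "card (sparse_lists {} bs) * 64 ^ count_list bs True \<le> card V ^ length bs * 128 ^ (4 * K * q)"
      by (rule card_sparse_lists[OF inv_state_init _ _ trans_le_add2[OF eq_imp_le[OF eq]]])
        (use that N_le in auto)
    moreover have "(4::nat) ^ N \<le> 4 ^ (3 * count_list bs True)" using that by (intro power_increasing) auto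
    moreover have "(4::nat) ^ (3 * count_list bs True) = 64 ^ count_list bs True" by (simp add: power_mult)
    ultimately show ?thesis using that
      by (smt (verit, ccfv_SIG) mem_Collect_eq mult_le_mono2 order_trans)
  qed
  have "card dense_sparse * 4 ^ N \<le> 2 ^ N * (card V ^ N * 128 ^ (4 * K * q))"
    unfolding dense_sparse_def using cB one finite_subset[OF sub finB] by (intro card_UN_mult_le)
  also have "(4::nat) ^ N = 2 ^ N * 2 ^ N" by (simp flip: power_mult_distrib)
  finally have "2 ^ N * (card dense_sparse * 2 ^ N) \<le> 2 ^ N * (card V ^ N * 128 ^ (4 * K * q))"
    by (simp only: mult_ac)
  then have "card dense_sparse * 2 ^ N \<le> card V ^ N * 128 ^ (4 * K * q)"
    by (metis mult_le_cancel1 zero_less_numeral zero_less_power)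
  also have "(128::nat) ^ (4 * K * q) = 2 ^ (7 * (4 * K * q))" by (simp add: power_mult)
  finally have "card dense_sparse * 2 ^ N \<le> card V ^ N * 2 ^ (7 * (4 * K * q))" .
  moreover have "2 ^ N = 2 ^ (N - 7 * (4 * K * q)) * (2::nat) ^ (7 * (4 * K * q))"
    by (simp flip: power_add)
  ultimately have "card dense_sparse * 2 ^ (N - 7 * (4 * K * q)) * 2 ^ (7 * (4 * K * q))
      \<le> card V ^ N * 2 ^ (7 * (4 * K * q))" by (simp only: mult.assoc)
  then have a: "card dense_sparse * 2 ^ (N - 7 * (4 * K * q)) \<le> card V ^ N"
    by (rule mult_right_le_imp_le) simp
  have "2 + 7 * (4 * K * q) \<le> N" using q_pos by (simp add: algebra_simps)
  then have "(2::nat) ^ 2 \<le> 2 ^ (N - 7 * (4 * K * q))" by (intro power_increasing) auto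
  then have "card dense_sparse * 4 \<le> card dense_sparse * 2 ^ (N - 7 * (4 * K * q))"
    by (intro mult_left_mono) auto
  then show ?thesis using a by linarith
qed

definition bad_indices :: "'a list \<Rightarrow> nat set" where
  "bad_indices xs = {i\<in>{..<N}. xs \<in> coincident i \<union> crowded i \<union> crossed i}"

text \<open>An index is bad with probability at most 3/60, so by Markov a tenth of the indices are
  bad with probability at most 1/2. Adding 1/4 for \<open>dense_sparse\<close> stays below
  1.\<close>

lemma exists_good_sample: "\<exists>xs\<in>samples. xs \<notin> dense_sparse \<and> 10 * card (bad_indices xs) < N"
proof (rule ccontr)
  assume no: "\<not> ?thesis"
  define Z where "Z = {xs \<in> samples. N \<le> 10 * card (bad_indices xs)}"
  have finZ: "finite Z" using finite_samples unfolding Z_def by simp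
  have fd: "finite dense_sparse"
    unfolding dense_sparse_def
    by (intro finite_UN_I finite_sparse_lists finite_subset[OF _ finite_lists_length_eq[of "UNIV::bool set" N]]) auto
  have "samples \<subseteq> dense_sparse \<union> Z" using no unfolding Z_def by auto
  then have "card samples \<le> card dense_sparse + card Z"
    using fd finZ by (meson card_Un_le card_mono finite_UnI order_trans)
  then have a: "card V ^ N \<le> card dense_sparse + card Z" using card_samples by simp
  have pt: "60 * card {xs \<in> samples. xs \<in> coincident i \<union> crowded i \<union> crossed i} \<le> 3 * card V ^ N" if "i < N" for i
  proof -
    have "card {xs \<in> samples. xs \<in> coincident i \<union> crowded i \<union> crossed i}
        \<le> card (coincident i \<union> crowded i \<union> crossed i)"
      using finite_samples by (intro card_mono) (auto simp: coincident_def crowded_def crossed_def)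
    also have "\<dots> \<le> card (coincident i) + card (crowded i) + card (crossed i)"
      by (meson add_le_mono1 card_Un_le order_trans)
    finally show ?thesis using card_coincident[OF that] card_crowded[OF that] card_crossed[OF that] by linarith
  qed
  have "(\<Sum>xs\<in>samples. card (bad_indices xs))
      = (\<Sum>i<N. card {xs \<in> samples. xs \<in> coincident i \<union> crowded i \<union> crossed i})"
    unfolding bad_indices_def by (rule sum_multicount_gen) (auto simp: finite_samples)
  then have "60 * (\<Sum>xs\<in>samples. card (bad_indices xs))
     = (\<Sum>i<N. 60 * card {xs \<in> samples. xs \<in> coincident i \<union> crowded i \<union> crossed i})"
    by (simp only: sum_distrib_left)
  also have "\<dots> \<le> (\<Sum>i<N. 3 * card V ^ N)" using pt by (intro sum_mono) auto
  finally have b: "60 * (\<Sum>xs\<in>samples. card (bad_indices xs)) \<le> N * (3 * card V ^ N)" by simp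
  have "card Z * N = (\<Sum>xs\<in>Z. N)" by simp
  also have "\<dots> \<le> (\<Sum>xs\<in>Z. 10 * card (bad_indices xs))" by (intro sum_mono) (simp add: Z_def)
  also have "\<dots> \<le> (\<Sum>xs\<in>samples. 10 * card (bad_indices xs))"
    using finite_samples by (intro sum_mono2) (auto simp: Z_def)
  finally have "card Z * N \<le> 10 * (\<Sum>xs\<in>samples. card (bad_indices xs))"
    by (simp only: sum_distrib_left)
  then have "6 * (card Z * N) \<le> N * (3 * card V ^ N)" using b by linarith
  then have "N * (6 * card Z) \<le> N * (3 * card V ^ N)" by (simp only: mult_ac)
  then have "6 * card Z \<le> 3 * card V ^ N" using N_pos by (metis mult_le_cancel1)
  moreover have "0 < card V ^ N" using V_nonempty finite_V by (simp add: card_gt_0_iff)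
  ultimately show False using a card_dense_sparse by linarith
qed

text \<open>Drop the bad indices of a good sample. At least 9/10 of it remains, so half of
  \<open>S\<close> uses more than \<open>N / 3\<close> indices and contains \<open>K + 1\<close>
  points of some line. No line has more points of \<open>S\<close> than that, so these are all of
  them.\<close>

lemma sparse_hitting_resistant_set:
  "\<exists>S\<subseteq>V. 9 * N \<le> 10 * card S \<and> card S \<le> N \<and>
     (\<forall>U\<subseteq>S. card S \<le> 2 * card U \<longrightarrow> (\<exists>l\<in>\<L>. Suc K \<le> card (l \<inter> S) \<and> l \<inter> S \<subseteq> U)) \<and>
     (\<forall>l\<in>\<L>. \<forall>l'\<in>\<L>. \<forall>v. v \<in> l \<longrightarrow> v \<in> l' \<longrightarrow> v \<notin> S \<longrightarrow> Suc K \<le> card (l \<inter> S) \<longrightarrow> Suc K \<le> card (l' \<inter> S) \<longrightarrow> l = l')"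
proof -
  obtain xs where xs: "xs \<in> samples" "xs \<notin> dense_sparse" "10 * card (bad_indices xs) < N"
    using exists_good_sample by auto
  have len: "length xs = N" "set xs \<subseteq> V" using xs(1) unfolding samples_def by auto
  define J where "J = {..<N} - bad_indices xs"
  have JN: "J \<subseteq> {..<N}" "finite J" unfolding J_def by auto
  have Jgood: "xs \<notin> coincident i" "xs \<notin> crowded i" "xs \<notin> crossed i" if "i \<in> J" for i
    using that unfolding J_def bad_indices_def by auto
  define S where "S = (\<lambda>i. xs ! i) ` J"
  have inj: "inj_on (\<lambda>i. xs ! i) J"
  proof (rule inj_onI, rule ccontr)
    fix i j assume h: "i \<in> J" "j \<in> J" "xs ! i = xs ! j" "i \<noteq> j"
    then have "xs \<in> coincident i" unfolding coincident_def using xs(1) JN by auto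
    then show False using Jgood h(1) by blast
  qed
  have SV: "S \<subseteq> V" unfolding S_def using len JN by (auto simp: subset_iff)
  have finS: "finite S" unfolding S_def using JN by simp
  have cS: "card S = card J" unfolding S_def by (rule card_image[OF inj])
  have "card J = N - card (bad_indices xs)"
    unfolding J_def by (subst card_Diff_subset) (auto simp: bad_indices_def)
  then have c: "9 * N \<le> 10 * card S" "card S \<le> N" using cS xs(3) by auto
  define I where "I l = {i \<in> J. xs ! i \<in> l}" for l
  have I: "I l \<subseteq> J" "finite (I l)" for l using JN(2) unfolding I_def by auto
  have cI: "card (I l) = card (l \<inter> S)" for l
  proof -
    have "l \<inter> S = (\<lambda>i. xs ! i) ` I l" unfolding I_def S_def by auto
    then show ?thesis using card_image[OF inj_on_subset[OF inj I(1)]] by simp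
  qed
  have le: "card (l \<inter> S) \<le> Suc K" if "l \<in> \<L>" for l
  proof (rule ccontr)
    assume "\<not> ?thesis"
    then have "Suc (Suc K) \<le> card (I l)" using cI by simp
    then obtain i where i: "i \<in> I l" by (metis card.empty ex_in_conv not_less_eq_eq zero_le)
    have "Suc K \<le> card (I l - {i})" using \<open>Suc (Suc K) \<le> card (I l)\<close> i I(2) by simp
    then obtain A where A: "A \<subseteq> I l - {i}" "card A = Suc K" by (meson obtain_subset_with_card_n)
    have "A \<subseteq> {..<N} - {i}" "\<forall>j\<in>A. xs ! j \<in> l" "xs ! i \<in> l" using A i JN unfolding I_def by auto
    then have "xs \<in> crowded i" unfolding crowded_def using xs(1) that A(2) by blast
    then show False using Jgood i I(1) by blast
  qed
  have half: "\<exists>l\<in>\<L>. Suc K \<le> card (l \<inter> S) \<and> l \<inter> S \<subseteq> U" if U: "U \<subseteq> S" "card S \<le> 2 * card U" for U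
  proof -
    define bs where "bs = map (\<lambda>i. i \<in> J \<and> xs ! i \<in> U) [0..<N]"
    have lbs: "length bs = N" unfolding bs_def by simp
    have mk: "marked bs xs = U"
    proof -
      have "marked bs xs = {xs ! i | i. i < N \<and> bs ! i}"
        unfolding marked_def using lbs len by (auto simp: set_zip)
      also have "\<dots> = {xs ! i | i. i < N \<and> i \<in> J \<and> xs ! i \<in> U}"
        unfolding bs_def by (intro Collect_cong ex_cong) auto
      also have "\<dots> = U" using U JN unfolding S_def by auto
      finally show ?thesis .
    qed
    have "count_list bs True = card {i. i < N \<and> bs ! i}"
      using lbs by (simp add: count_list_eq_length_filter length_filter_conv_card eq_commute[of True])
    also have "{i. i < N \<and> bs ! i} = I U" unfolding I_def bs_def using JN by auto
    finally have "count_list bs True = card U" using cI[of U] U(1) by (simp add: Int_absorb2)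
    then have "N \<le> 3 * count_list bs True" using U(2) c by linarith
    then have "xs \<notin> sparse_lists {} bs" using xs(2) lbs unfolding dense_sparse_def by auto
    then obtain l where l: "l \<in> \<L>" "Suc K \<le> card (l \<inter> U)"
      unfolding sparse_lists_def using lbs len mk by (auto simp: not_le Suc_le_eq)
    have "l \<inter> U = l \<inter> S"
      using le[OF l(1)] l(2) U(1) finS by (intro card_seteq) auto
    then show ?thesis using l by (intro bexI[of _ l]) auto
  qed
  have cross: "l = l'" if h: "l \<in> \<L>" "l' \<in> \<L>" "v \<in> l" "v \<in> l'" "v \<notin> S" "Suc K \<le> card (l \<inter> S)" "Suc K \<le> card (l' \<inter> S)" for l l' v
  proof (rule ccontr)
    assume ne: "l \<noteq> l'"
    \<comment> \<open>The lines meet only in \<open>v\<close>, which is not in \<open>S\<close>;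
      this yields the disjoint index sets that \<open>crossed\<close> demands.\<close>
    have disj: "I l \<inter> I l' = {}"
    proof (rule ccontr)
      assume "I l \<inter> I l' \<noteq> {}"
      then obtain i where "i \<in> J" "xs ! i \<in> l" "xs ! i \<in> l'" unfolding I_def by auto
      then have "xs ! i = v" "xs ! i \<in> S" using lines_meet_once[OF h(1,2) ne] h(3,4) unfolding S_def by auto
      then show False using h(5) by simp
    qed
    have "Suc K \<le> card (I l)" using h cI by simp
    then obtain i where i: "i \<in> I l" by (metis card.empty ex_in_conv not_less_eq_eq zero_le)
    have "K \<le> card (I l - {i})" using \<open>Suc K \<le> card (I l)\<close> i I(2) by simp
    then obtain A where A: "A \<subseteq> I l - {i}" "card A = K" by (meson obtain_subset_with_card_n)
    have "Suc K \<le> card (I l')" using h cI by simp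
    then obtain A' where A': "A' \<subseteq> I l'" "card A' = Suc K" by (meson obtain_subset_with_card_n)
    have "A \<subseteq> {..<N} - {i}" "\<forall>j\<in>A. xs ! j \<in> l" "xs ! i \<in> l" using A i JN unfolding I_def by auto
    moreover have "A' \<subseteq> {..<N} - {i}" "\<forall>j\<in>A'. xs ! j \<in> l'" "A \<inter> A' = {}"
      using A A' i JN disj unfolding I_def by auto
    moreover have "l \<inter> l' \<noteq> {}" using h by auto
    ultimately have "xs \<in> crossed i" unfolding crossed_def using xs(1) h(1,2) A(2) A'(2) by blast
    then show False using Jgood i I(1) by blast
  qed
  show ?thesis using SV c half cross by (intro exI[of _ S]) blast
qed

end

section \<open>Generic projections of the grid\<close>

text \<open>The larger exponent is determined because \<open>2 * 3 ^ b < 3 ^ Suc b\<close>;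
  cancelling it determines the other.\<close>

lemma three_power_sum_eq:
  fixes a b \<alpha> \<beta> :: nat
  assumes "(3::nat) ^ a + 3 ^ b = 3 ^ \<alpha> + 3 ^ \<beta>"
  shows "(a = \<alpha> \<and> b = \<beta>) \<or> (a = \<beta> \<and> b = \<alpha>)"
proof -
  have key: "b = \<beta> \<and> a = \<alpha>" if le: "a \<le> b" "\<alpha> \<le> \<beta>" and eq: "(3::nat) ^ a + 3 ^ b = 3 ^ \<alpha> + 3 ^ \<beta>" for a b \<alpha> \<beta> :: nat
  proof -
    have less: "(3::nat) ^ a + 3 ^ b < 3 ^ \<beta>" if "a \<le> b" "b < \<beta>" for a b \<beta> :: nat
    proof -
      have "(3::nat) ^ a \<le> 3 ^ b" using that by (intro power_increasing) auto
      moreover have "(3::nat) ^ Suc b \<le> 3 ^ \<beta>" using that by (intro power_increasing) auto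
      moreover have "0 < (3::nat) ^ b" by simp
      ultimately show ?thesis unfolding power_Suc by linarith
    qed
    have "b = \<beta>"
    proof (rule ccontr)
      assume "b \<noteq> \<beta>"
      then consider "b < \<beta>" | "\<beta> < b" by linarith
      then show False using less[OF le(1), of \<beta>] less[OF le(2), of b] eq by cases auto
    qed
    then show ?thesis using eq by simp
  qed
  consider "a \<le> b" "\<alpha> \<le> \<beta>" | "a \<le> b" "\<beta> \<le> \<alpha>" | "b \<le> a" "\<alpha> \<le> \<beta>" | "b \<le> a" "\<beta> \<le> \<alpha>" by linarith
  then show ?thesis
    using key[of a b \<alpha> \<beta>] key[of a b \<beta> \<alpha>] key[of b a \<alpha> \<beta>] key[of b a \<beta> \<alpha>] assms
    by cases (auto simp: add.commute)
qed

text \<open>With \<open>z a = t ^ 3 ^ a\<close> distinct monomials \<open>z a * z b\<close> are distinct powers of \<open>t\<close>.\<close>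

lemma generic_slopes:
  fixes F :: "(nat \<Rightarrow> nat \<Rightarrow> real) set"
  assumes "finite F"
  shows "\<exists>z :: nat \<Rightarrow> real. \<forall>f\<in>F. (\<Sum>a<d. \<Sum>b<d. f a b * (z a * z b)) = 0 \<longrightarrow>
           (\<forall>\<alpha><d. \<forall>\<beta><d. f \<alpha> \<beta> + f \<beta> \<alpha> = 0)"
proof -
  define P where "P f = (\<Sum>a<d. \<Sum>b<d. monom (f a b) (3 ^ a + 3 ^ b))" for f :: "nat \<Rightarrow> nat \<Rightarrow> real"
  have P0: "f \<alpha> \<beta> + f \<beta> \<alpha> = 0" if "P f = 0" "\<alpha> < d" "\<beta> < d" for f \<alpha> \<beta>
  proof -
    let ?h = "\<lambda>a b. if (a = \<alpha> \<and> b = \<beta>) \<or> (a = \<beta> \<and> b = \<alpha>) then f a b else 0"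
    have "0 = coeff (P f) (3 ^ \<alpha> + 3 ^ \<beta>)" using that(1) by simp
    also have "\<dots> = (\<Sum>a<d. \<Sum>b<d. if 3 ^ a + 3 ^ b = (3 ^ \<alpha> + 3 ^ \<beta> :: nat) then f a b else 0)"
      unfolding P_def by (simp add: coeff_sum)
    also have "\<dots> = (\<Sum>a<d. \<Sum>b<d. ?h a b)"
    proof (intro sum.cong refl)
      fix a b
      have "3 ^ a + 3 ^ b = (3 ^ \<alpha> + 3 ^ \<beta> :: nat) \<longleftrightarrow> (a = \<alpha> \<and> b = \<beta>) \<or> (a = \<beta> \<and> b = \<alpha>)"
        using three_power_sum_eq[of a b \<alpha> \<beta>] by (auto simp: add.commute)
      then show "(if 3 ^ a + 3 ^ b = (3 ^ \<alpha> + 3 ^ \<beta> :: nat) then f a b else 0) = ?h a b" by simp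
    qed
    finally have s: "(\<Sum>a<d. \<Sum>b<d. ?h a b) = 0" by simp
    \<comment> \<open>The guard \<open>\<alpha> \<noteq> \<beta>\<close> keeps a diagonal
      coefficient from being counted twice.\<close>
    have inner: "(\<Sum>b<d. ?h a b) = (if a = \<alpha> then f a \<beta> else 0) + (if a = \<beta> \<and> \<alpha> \<noteq> \<beta> then f a \<alpha> else 0)" for a
    proof -
      have "(\<Sum>b<d. ?h a b) = (\<Sum>b<d. (if b = \<beta> then (if a = \<alpha> then f a \<beta> else 0) else 0)
          + (if b = \<alpha> then (if a = \<beta> \<and> \<alpha> \<noteq> \<beta> then f a \<alpha> else 0) else 0))"
        by (intro sum.cong) auto
      then show ?thesis using that by (simp add: sum.distrib sum.delta)
    qed
    have "(\<Sum>a<d. \<Sum>b<d. ?h a b) = f \<alpha> \<beta> + (if \<alpha> \<noteq> \<beta> then f \<beta> \<alpha> else 0)"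
    proof -
      have "(\<Sum>a<d. \<Sum>b<d. ?h a b) = (\<Sum>a<d. (if a = \<alpha> then f \<alpha> \<beta> else 0) + (if a = \<beta> then (if \<alpha> \<noteq> \<beta> then f \<beta> \<alpha> else 0) else 0))"
        unfolding inner by (intro sum.cong) auto
      then show ?thesis using that by (simp add: sum.distrib sum.delta)
    qed
    then show ?thesis using s by (auto split: if_splits)
  qed
  \<comment> \<open>Finitely many nonzero polynomials have finitely many roots; for any other
    \<open>t\<close>, vanishing at \<open>t\<close> means vanishing identically.\<close>
  have "finite (\<Union>f\<in>{f \<in> F. P f \<noteq> 0}. {t. poly (P f) t = 0})"
    using assms by (intro finite_UN_I) (auto simp: poly_roots_finite)
  then obtain t where t: "t \<notin> (\<Union>f\<in>{f \<in> F. P f \<noteq> 0}. {t. poly (P f) t = 0})"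
    using ex_new_if_finite[OF infinite_UNIV_char_0[where 'a = real]] by blast
  define z where "z a = t ^ (3 ^ a)" for a :: nat
  have "poly (P f) t = (\<Sum>a<d. \<Sum>b<d. f a b * (z a * z b))" for f
    unfolding P_def z_def by (simp add: poly_sum poly_monom power_add)
  then have "\<forall>f\<in>F. (\<Sum>a<d. \<Sum>b<d. f a b * (z a * z b)) = 0 \<longrightarrow>
           (\<forall>\<alpha><d. \<forall>\<beta><d. f \<alpha> \<beta> + f \<beta> \<alpha> = 0)"
    using t P0 by auto
  then show ?thesis by blast
qed

section \<open>The grid and its axis-parallel lines\<close>

locale grid =
  fixes n d :: nat
  assumes n_ge: "2 \<le> n" and d_pos: "0 < d"
begin

text \<open>The functions are extensional, so agreement on the \<open>d\<close> coordinates is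
  equality and \<open>axis_line\<close> may quantify over all indices.\<close>

definition points :: "(nat \<Rightarrow> nat) set" where
  "points = ({..<d} \<rightarrow>\<^sub>E {..<n})"

definition axis_line :: "nat \<Rightarrow> (nat \<Rightarrow> nat) \<Rightarrow> (nat \<Rightarrow> nat) set" where
  "axis_line c x = {y \<in> points. \<forall>i. i \<noteq> c \<longrightarrow> y i = x i}"

definition axis_lines :: "(nat \<Rightarrow> nat) set set" where
  "axis_lines = {axis_line c x | c x. c < d \<and> x \<in> points}"

lemma finite_points: "finite points"
  unfolding points_def by (intro finite_PiE) auto

lemma card_points: "card points = n ^ d"
  unfolding points_def by (simp add: card_PiE)

lemma points_upd: "x \<in> points \<Longrightarrow> c < d \<Longrightarrow> t < n \<Longrightarrow> x(c := t) \<in> points"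
  unfolding points_def by (auto simp: PiE_iff extensional_def)

lemma points_less: "x \<in> points \<Longrightarrow> c < d \<Longrightarrow> x c < n"
  unfolding points_def by (auto simp: PiE_iff)

lemma points_eqI:
  assumes "x \<in> points" "y \<in> points" "\<And>m. m < d \<Longrightarrow> x m = y m"
  shows "x = y"
  using assms unfolding points_def by (auto intro: PiE_ext)

lemma axis_line_self: "x \<in> points \<Longrightarrow> x \<in> axis_line c x"
  unfolding axis_line_def by simp

lemma axis_line_eq: "y \<in> axis_line c x \<Longrightarrow> axis_line c y = axis_line c x"
  unfolding axis_line_def by auto

lemma axis_line_image:
  assumes "x \<in> points" "c < d"
  shows "axis_line c x = (\<lambda>t. x(c := t)) ` {..<n}"
proof (intro equalityI subsetI)
  fix y assume y: "y \<in> axis_line c x"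
  then have "y = x(c := y c)" unfolding axis_line_def by auto
  moreover have "y c < n" using y assms points_less unfolding axis_line_def by auto
  ultimately show "y \<in> (\<lambda>t. x(c := t)) ` {..<n}" by auto
next
  fix y assume "y \<in> (\<lambda>t. x(c := t)) ` {..<n}"
  then show "y \<in> axis_line c x" unfolding axis_line_def using points_upd assms by auto
qed

text \<open>As \<open>n \<ge> 2\<close>, the line has two points that differ in coordinate
  \<open>c\<close>, and no line of another direction contains both.\<close>

lemma axis_line_direction:
  assumes "x \<in> points" "c < d" "axis_line c x = axis_line c' x'"
  shows "c = c'"
proof (rule ccontr)
  assume ne: "c \<noteq> c'"
  obtain t where t: "t < n" "t \<noteq> x c"
    using n_ge by (metis One_nat_def Suc_1 Suc_le_lessD lessI less_trans zero_less_one zero_neq_one)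
  have "x(c := t) \<in> axis_line c' x'" "x \<in> axis_line c' x'"
    using assms axis_line_image[OF assms(1,2)] t axis_line_self[OF assms(1)] by auto
  then have "(x(c := t)) c = x' c" "x c = x' c" using ne unfolding axis_line_def by auto
  then show False using t by simp
qed

sublocale linear_space points axis_lines n d
proof
  show "finite points" by (rule finite_points)
  show "points \<noteq> {}" using card_points n_ge by (metis card.empty not_numeral_le_zero power_not_zero)
  fix l assume "l \<in> axis_lines"
  then obtain c x where l: "l = axis_line c x" "c < d" "x \<in> points" unfolding axis_lines_def by auto
  show "l \<subseteq> points" using l unfolding axis_line_def by auto
  have "inj_on (\<lambda>t. x(c := t)) {..<n}" by (intro inj_onI) (metis fun_upd_same)
  then show "card l = n" using axis_line_image[OF l(3,2)] l(1) card_image by fastforce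
next
  fix x assume x: "x \<in> points"
  have "{l \<in> axis_lines. x \<in> l} = (\<lambda>c. axis_line c x) ` {..<d}"
    using axis_line_eq axis_line_self[OF x] x unfolding axis_lines_def by fastforce
  moreover have "inj_on (\<lambda>c. axis_line c x) {..<d}"
    using axis_line_direction[OF x] by (intro inj_onI) auto
  ultimately show "card {l \<in> axis_lines. x \<in> l} = d" by (simp add: card_image)
next
  fix l l' p p' assume h: "l \<in> axis_lines" "l' \<in> axis_lines" "l \<noteq> l'" "p \<in> l" "p \<in> l'" "p' \<in> l" "p' \<in> l'"
  then obtain c x c' x' where l: "l = axis_line c x" "l' = axis_line c' x'" unfolding axis_lines_def by auto
  have ne: "c \<noteq> c'" using h(3-5) l axis_line_eq by metis
  show "p = p'"
  proof
    fix m
    show "p m = p' m" using h(4-7) ne unfolding l axis_line_def by (cases "m = c") auto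
  qed
qed

text \<open>
The projection sends \<open>x\<close> to \<open>(\<Sum> x m, \<Sum> x m * z m)\<close>, so the image of \<open>axis_line c x\<close> has slope \<open>z c\<close> and
intercept \<open>\<Sum> lin_coeff c x m * z m\<close>. Every degeneracy to be avoided is the vanishing of a quadratic
form in \<open>z\<close>; conditions linear in \<open>z\<close> are squared. \<open>concurrency_form\<close> is the determinant of three
line equations.
\<close>

definition lin_coeff :: "nat \<Rightarrow> (nat \<Rightarrow> nat) \<Rightarrow> nat \<Rightarrow> real" where
  "lin_coeff c x m = real (x m) - (if m = c then (\<Sum>j<d. real (x j)) else 0)"

definition delta :: "nat \<Rightarrow> nat \<Rightarrow> real" where
  "delta c m = (if m = c then 1 else 0)"

definition concurrency_form :: "nat \<Rightarrow> (nat \<Rightarrow> nat) \<Rightarrow> nat \<Rightarrow> (nat \<Rightarrow> nat) \<Rightarrow> nat \<Rightarrow> (nat \<Rightarrow> nat) \<Rightarrow> nat \<Rightarrow> nat \<Rightarrow> real" where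
  "concurrency_form c\<^sub>1 x\<^sub>1 c\<^sub>2 x\<^sub>2 c\<^sub>3 x\<^sub>3 a b =
     lin_coeff c\<^sub>1 x\<^sub>1 a * (delta c\<^sub>2 b - delta c\<^sub>3 b) + lin_coeff c\<^sub>2 x\<^sub>2 a * (delta c\<^sub>3 b - delta c\<^sub>1 b)
       + lin_coeff c\<^sub>3 x\<^sub>3 a * (delta c\<^sub>1 b - delta c\<^sub>2 b)"

definition parallel_form :: "nat \<Rightarrow> (nat \<Rightarrow> nat) \<Rightarrow> (nat \<Rightarrow> nat) \<Rightarrow> nat \<Rightarrow> nat \<Rightarrow> real" where
  "parallel_form c x y a b = (lin_coeff c x a - lin_coeff c y a) * (lin_coeff c x b - lin_coeff c y b)"

definition slope_form :: "nat \<Rightarrow> nat \<Rightarrow> nat \<Rightarrow> nat \<Rightarrow> real" where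
  "slope_form c c' a b = (delta c a - delta c' a) * (delta c b - delta c' b)"

definition forms :: "(nat \<Rightarrow> nat \<Rightarrow> real) set" where
  "forms = (\<lambda>(c\<^sub>1, x\<^sub>1, c\<^sub>2, x\<^sub>2, c\<^sub>3, x\<^sub>3). concurrency_form c\<^sub>1 x\<^sub>1 c\<^sub>2 x\<^sub>2 c\<^sub>3 x\<^sub>3)
        ` ({..<d} \<times> points \<times> {..<d} \<times> points \<times> {..<d} \<times> points)
     \<union> (\<lambda>(c, x, y). parallel_form c x y) ` ({..<d} \<times> points \<times> points)
     \<union> (\<lambda>(c, c'). slope_form c c') ` ({..<d} \<times> {..<d})"

lemma finite_forms: "finite forms"
  unfolding forms_def using finite_points by auto

definition vanishes :: "(nat \<Rightarrow> real) \<Rightarrow> (nat \<Rightarrow> nat \<Rightarrow> real) \<Rightarrow> bool" where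
  "vanishes z f \<longleftrightarrow> (\<Sum>a<d. \<Sum>b<d. f a b * (z a * z b)) = 0"

end

text \<open>The sums \<open>f \<alpha> \<beta> + f \<beta> \<alpha>\<close> are, up to a factor 2 on
  the diagonal, the coefficients of the quadratic form: a listed form that vanishes at
  \<open>z\<close> vanishes identically.\<close>

locale generic_projection = grid +
  fixes z :: "nat \<Rightarrow> real"
  assumes generic: "\<And>f \<alpha> \<beta>. f \<in> forms \<Longrightarrow> vanishes z f \<Longrightarrow> \<alpha> < d \<Longrightarrow> \<beta> < d \<Longrightarrow> f \<alpha> \<beta> + f \<beta> \<alpha> = 0"
begin

section \<open>Images of axis-parallel lines under the projection\<close>

definition lf :: "(nat \<Rightarrow> real) \<Rightarrow> real" where
  "lf g = (\<Sum>m<d. g m * z m)"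

lemma lf_diff: "lf (\<lambda>m. g m - h m) = lf g - lf h"
  unfolding lf_def by (simp add: sum_subtractf left_diff_distrib)

lemma lf_delta: "c < d \<Longrightarrow> lf (delta c) = z c"
  unfolding lf_def delta_def by (simp add: if_distrib[of "\<lambda>u. u * _"] sum.delta cong: if_cong)

lemma lf_mult: "(\<Sum>a<d. \<Sum>b<d. (g a * h b) * (z a * z b)) = lf g * lf h"
  unfolding lf_def sum_product by (intro sum.cong) (auto simp: mult_ac)

definition proj :: "(nat \<Rightarrow> nat) \<Rightarrow> real \<times> real" where
  "proj x = (\<Sum>m<d. real (x m), \<Sum>m<d. real (x m) * z m)"

definition plane_line :: "nat \<Rightarrow> (nat \<Rightarrow> nat) \<Rightarrow> (real \<times> real) set" where
  "plane_line c x = {(u, w). w - z c * u = lf (lin_coeff c x)}"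

lemma plane_line_in: "plane_line c x \<in> plane_lines"
  unfolding plane_lines_def plane_line_def
  by (intro CollectI exI[of _ "- z c"] exI[of _ 1] exI[of _ "lf (lin_coeff c x)"]) auto

text \<open>In this shape the summand \<open>m = c\<close> disappears, so all points of an axis line
  have the same intercept.\<close>

lemma lf_lin_coeff:
  assumes "c < d"
  shows "lf (lin_coeff c x) = (\<Sum>m<d. real (x m) * (z m - z c))"
proof -
  have "lf (lin_coeff c x) = (\<Sum>m<d. real (x m) * z m - (if m = c then (\<Sum>j<d. real (x j)) * z c else 0))"
    unfolding lf_def lin_coeff_def by (intro sum.cong) (auto simp: left_diff_distrib)
  also have "\<dots> = (\<Sum>m<d. real (x m) * z m) - (\<Sum>j<d. real (x j)) * z c"
    using assms by (simp add: sum_subtractf sum.delta)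
  also have "\<dots> = (\<Sum>m<d. real (x m) * (z m - z c))"
    by (simp add: right_diff_distrib sum_subtractf sum_distrib_right)
  finally show ?thesis .
qed

lemma proj_in_plane_line:
  assumes "c < d" "y \<in> axis_line c x"
  shows "proj y \<in> plane_line c x"
proof -
  have "(\<Sum>m<d. real (y m) * z m) - z c * (\<Sum>m<d. real (y m)) = (\<Sum>m<d. real (y m) * (z m - z c))"
    by (simp add: right_diff_distrib sum_subtractf sum_distrib_left mult.commute)
  also have "\<dots> = (\<Sum>m<d. real (x m) * (z m - z c))"
    using assms(2) unfolding axis_line_def by (intro sum.cong) auto
  finally show ?thesis unfolding plane_line_def proj_def using lf_lin_coeff[OF assms(1)] by simp
qed

lemma slopes_distinct:
  assumes "c < d" "c' < d" "z c = z c'"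
  shows "c = c'"
proof (rule ccontr)
  assume ne: "c \<noteq> c'"
  have "vanishes z (slope_form c c')"
    unfolding vanishes_def slope_form_def lf_mult lf_diff using lf_delta assms by simp
  moreover have "slope_form c c' \<in> forms" unfolding forms_def using assms by auto
  ultimately have "slope_form c c' c c + slope_form c c' c c = 0" using generic assms by blast
  then show False using ne unfolding slope_form_def delta_def by simp
qed

text \<open>Equal slope and a common point give equal intercepts, so the squared difference vanishes
  at \<open>z\<close> and genericity equates the coefficients. Off \<open>c\<close> these are the
  coordinates, which fix the axis line.\<close>

lemma parallel_lines:
  assumes "c < d" "x \<in> points" "y \<in> points" "p \<in> plane_line c x" "p \<in> plane_line c y"
  shows "lin_coeff c x m = lin_coeff c y m \<or> d \<le> m" "axis_line c x = axis_line c y"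
proof -
  have "lf (lin_coeff c x) = lf (lin_coeff c y)" using assms(4,5) unfolding plane_line_def by auto
  then have "vanishes z (parallel_form c x y)"
    unfolding vanishes_def parallel_form_def lf_mult lf_diff by simp
  moreover have "parallel_form c x y \<in> forms" unfolding forms_def using assms by force
  ultimately have "parallel_form c x y m m + parallel_form c x y m m = 0" if "m < d" for m
    using generic that by blast
  then have eq: "lin_coeff c x m = lin_coeff c y m" if "m < d" for m
    using that unfolding parallel_form_def by fastforce
  then show "lin_coeff c x m = lin_coeff c y m \<or> d \<le> m" by (meson not_le)
  have "x m = y m" if "m \<noteq> c" for m
  proof (cases "m < d")
    case True
    then show ?thesis using eq[OF True] that unfolding lin_coeff_def by simp
  next
    case False
    then show ?thesis using assms(2,3) unfolding points_def PiE_def extensional_def by auto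
  qed
  then show "axis_line c x = axis_line c y" unfolding axis_line_def by auto
qed

lemma inj_on_proj: "inj_on proj points"
proof (rule inj_onI)
  fix x y assume h: "x \<in> points" "y \<in> points" "proj x = proj y"
  have "proj x \<in> plane_line 0 x" "proj x \<in> plane_line 0 y"
    using proj_in_plane_line[OF d_pos axis_line_self[OF h(1)]]
      proj_in_plane_line[OF d_pos axis_line_self[OF h(2)]] h(3) by simp_all
  then have eq: "lin_coeff 0 x m = lin_coeff 0 y m" if "m < d" for m
    using parallel_lines(1)[OF d_pos h(1,2)] that not_le by blast
  \<comment> \<open>\<open>lin_coeff 0 x 0\<close> is coordinate 0 minus the coordinate sum; the
    first component of \<open>proj\<close> supplies that sum.\<close>
  have "(\<Sum>j<d. real (x j)) = (\<Sum>j<d. real (y j))" using h(3) unfolding proj_def by simp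
  then have "x m = y m" if "m < d" for m
    using eq[OF that] unfolding lin_coeff_def by (auto split: if_splits)
  then show "x = y" using points_eqI h by blast
qed

text \<open>The determinant vanishes at \<open>z\<close>, hence identically. Its coefficients at
  \<open>(m, c\<^sub>3)\<close> say that the base points of the first two lines agree off
  \<open>c\<^sub>1\<close> and \<open>c\<^sub>2\<close>, so these lines already meet in the
  grid.\<close>

lemma concurrent_lines:
  assumes c: "c\<^sub>1 < d" "c\<^sub>2 < d" "c\<^sub>3 < d" "c\<^sub>1 \<noteq> c\<^sub>2" "c\<^sub>1 \<noteq> c\<^sub>3" "c\<^sub>2 \<noteq> c\<^sub>3"
    and x: "x\<^sub>1 \<in> points" "x\<^sub>2 \<in> points" "x\<^sub>3 \<in> points"
    and p: "p \<in> plane_line c\<^sub>1 x\<^sub>1" "p \<in> plane_line c\<^sub>2 x\<^sub>2" "p \<in> plane_line c\<^sub>3 x\<^sub>3"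
  shows "\<exists>v\<in>points. v \<in> axis_line c\<^sub>1 x\<^sub>1 \<and> v \<in> axis_line c\<^sub>2 x\<^sub>2 \<and> proj v = p"
proof -
  let ?f = "concurrency_form c\<^sub>1 x\<^sub>1 c\<^sub>2 x\<^sub>2 c\<^sub>3 x\<^sub>3"
  obtain u w where uw: "p = (u, w)" by (cases p)
  have e: "lf (lin_coeff c\<^sub>1 x\<^sub>1) = w - z c\<^sub>1 * u" "lf (lin_coeff c\<^sub>2 x\<^sub>2) = w - z c\<^sub>2 * u"
    "lf (lin_coeff c\<^sub>3 x\<^sub>3) = w - z c\<^sub>3 * u" using p uw unfolding plane_line_def by auto
  have "(\<Sum>a<d. \<Sum>b<d. ?f a b * (z a * z b)) =
      lf (lin_coeff c\<^sub>1 x\<^sub>1) * (z c\<^sub>2 - z c\<^sub>3) + lf (lin_coeff c\<^sub>2 x\<^sub>2) * (z c\<^sub>3 - z c\<^sub>1) + lf (lin_coeff c\<^sub>3 x\<^sub>3) * (z c\<^sub>1 - z c\<^sub>2)"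
    unfolding concurrency_form_def distrib_right sum.distrib lf_mult lf_diff using lf_delta c by simp
  also have "\<dots> = 0" unfolding e by (simp add: algebra_simps)
  finally have van: "vanishes z ?f" unfolding vanishes_def .
  have "?f \<in> forms" unfolding forms_def using c x by force
  then have g: "?f \<alpha> \<beta> + ?f \<beta> \<alpha> = 0" if "\<alpha> < d" "\<beta> < d" for \<alpha> \<beta>
    using generic van that by blast
  have off: "x\<^sub>1 m = x\<^sub>2 m" if "m \<noteq> c\<^sub>1" "m \<noteq> c\<^sub>2" for m
  proof (cases "m < d")
    case True
    show ?thesis
    proof (cases "m = c\<^sub>3")
      case True
      then show ?thesis using g[OF c(3,3)] c unfolding concurrency_form_def delta_def lin_coeff_def by simp
    next
      case False
      then show ?thesis using g[OF True c(3)] that c unfolding concurrency_form_def delta_def lin_coeff_def by simp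
    qed
  next
    case False
    then show ?thesis using x(1,2) unfolding points_def PiE_def extensional_def by auto
  qed
  define v where "v = x\<^sub>1(c\<^sub>1 := x\<^sub>2 c\<^sub>1)"
  have v: "v \<in> points" unfolding v_def using points_upd x points_less c by blast
  have v1: "v \<in> axis_line c\<^sub>1 x\<^sub>1" using v unfolding axis_line_def v_def by auto
  have v2: "v \<in> axis_line c\<^sub>2 x\<^sub>2" using v off unfolding axis_line_def v_def by auto
  obtain u' w' where v': "proj v = (u', w')" by (cases "proj v")
  have "w' - z c\<^sub>1 * u' = w - z c\<^sub>1 * u" "w' - z c\<^sub>2 * u' = w - z c\<^sub>2 * u"
    using proj_in_plane_line[OF c(1) v1] proj_in_plane_line[OF c(2) v2] v' e unfolding plane_line_def by auto
  then have "(z c\<^sub>1 - z c\<^sub>2) * (u' - u) = 0" by (simp add: algebra_simps)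
  moreover have "z c\<^sub>1 \<noteq> z c\<^sub>2" using slopes_distinct c by blast
  ultimately have "u' = u" by simp
  then have "proj v = p" using \<open>w' - z c\<^sub>1 * u' = w - z c\<^sub>1 * u\<close> v' uw by simp
  then show ?thesis using v v1 v2 by blast
qed

text \<open>Net points are traded for a set \<open>T'\<close> of at most \<open>2 * card T\<close>
  points of \<open>S\<close> that meets every rich line. If \<open>S - T'\<close> were at least half
  of \<open>S\<close>, then \<open>half\<close> would give a rich line avoiding
  \<open>T'\<close>.\<close>

lemma weak_net_large:
  assumes S: "S \<subseteq> points"
    and half: "\<And>U. U \<subseteq> S \<Longrightarrow> card S \<le> 2 * card U \<Longrightarrow> \<exists>l\<in>axis_lines. k \<le> card (l \<inter> S) \<and> l \<inter> S \<subseteq> U"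
    and cross: "\<And>l l' v. l \<in> axis_lines \<Longrightarrow> l' \<in> axis_lines \<Longrightarrow> v \<in> l \<Longrightarrow> v \<in> l' \<Longrightarrow> v \<notin> S \<Longrightarrow>
        k \<le> card (l \<inter> S) \<Longrightarrow> k \<le> card (l' \<inter> S) \<Longrightarrow> l = l'"
    and k: "0 < k" and T: "finite T" and eps: "eps * real (card S) = real k"
    and net: "weak_eps_net_lines eps (proj ` S) T"
  shows "card S \<le> 4 * card T"
proof -
  have finS: "finite S" using S finite_points finite_subset by blast
  have injS: "inj_on proj S" using inj_on_proj S inj_on_subset by blast
  define hits where "hits p l \<longleftrightarrow> (\<exists>c x. c < d \<and> x \<in> points \<and> l = axis_line c x \<and> p \<in> plane_line c x)" for p l
  define rich where "rich = {l \<in> axis_lines. k \<le> card (l \<inter> S)}"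
  have hit: "\<exists>p\<in>T. hits p l" if lr: "l \<in> rich" for l
  proof -
    obtain c x where l: "c < d" "x \<in> points" "l = axis_line c x" "k \<le> card (l \<inter> S)"
      using lr unfolding rich_def axis_lines_def by auto
    have "card (l \<inter> S) = card (proj ` (l \<inter> S))"
      using card_image[OF inj_on_subset[OF injS, of "l \<inter> S"]] by simp
    also have "\<dots> \<le> card (plane_line c x \<inter> proj ` S)"
      using proj_in_plane_line[OF l(1)] l(3) finS by (intro card_mono) auto
    finally have "real k \<le> real (card (plane_line c x \<inter> proj ` S))" using l(4) by linarith
    then have "plane_line c x \<inter> T \<noteq> {}"
      using net plane_line_in[of c x] eps card_image[OF injS] unfolding weak_eps_net_lines_def by auto
    then show ?thesis unfolding hits_def using l by blast
  qed
  have at_point: "v \<in> l" if "hits (proj v) l" "v \<in> points" for v l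
  proof -
    obtain c x where l: "c < d" "x \<in> points" "l = axis_line c x" "proj v \<in> plane_line c x"
      using \<open>hits (proj v) l\<close> unfolding hits_def by auto
    have "proj v \<in> plane_line c v" by (rule proj_in_plane_line[OF l(1) axis_line_self[OF that(2)]])
    then have "axis_line c v = axis_line c x" using parallel_lines(2)[OF l(1) that(2) l(2) _ l(4)] by blast
    then show ?thesis using axis_line_self[OF that(2)] l(3) by blast
  qed
  \<comment> \<open>Three rich lines through \<open>p\<close> have distinct directions, as parallel
    ones would coincide. Then \<open>p\<close> is the image of a grid point outside \<open>S\<close>
    on two rich lines, against \<open>cross\<close>.\<close>
  have two: "card {l \<in> rich. hits p l} \<le> 2" if "p \<notin> proj ` S" for p
  proof (rule ccontr)
    assume "\<not> ?thesis"
    then have "3 \<le> card {l \<in> rich. hits p l}" by simp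
    then obtain Q where Q: "Q \<subseteq> {l \<in> rich. hits p l}" "card Q = 3" by (meson obtain_subset_with_card_n)
    then obtain l1 l2 l3 where l: "Q = {l1, l2, l3}" "l1 \<noteq> l2" "l1 \<noteq> l3" "l2 \<noteq> l3"
      by (auto simp: card_3_iff)
    have r: "l1 \<in> rich" "l2 \<in> rich" "hits p l1" "hits p l2" "hits p l3" using Q(1) l(1) by auto
    obtain c1 x1 where 1: "c1 < d" "x1 \<in> points" "l1 = axis_line c1 x1" "p \<in> plane_line c1 x1"
      using r(3) unfolding hits_def by auto
    obtain c2 x2 where 2: "c2 < d" "x2 \<in> points" "l2 = axis_line c2 x2" "p \<in> plane_line c2 x2"
      using r(4) unfolding hits_def by auto
    obtain c3 x3 where 3: "c3 < d" "x3 \<in> points" "l3 = axis_line c3 x3" "p \<in> plane_line c3 x3"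
      using r(5) unfolding hits_def by auto
    have ne: "c1 \<noteq> c2" "c1 \<noteq> c3" "c2 \<noteq> c3"
      using parallel_lines(2) 1 2 3 l(2-4) by metis+
    obtain v where v: "v \<in> points" "v \<in> l1" "v \<in> l2" "proj v = p"
      using concurrent_lines[OF 1(1) 2(1) 3(1) ne 1(2) 2(2) 3(2) 1(4) 2(4) 3(4)] 1(3) 2(3) by blast
    have "v \<notin> S" using v(4) that by auto
    then show False using cross[of l1 l2 v] r(1,2) v l(2) unfolding rich_def by blast
  qed
  define pick where "pick l = (SOME v. v \<in> l \<inter> S)" for l
  have pick: "pick l \<in> l \<inter> S" if "l \<in> rich" for l
  proof -
    have "l \<inter> S \<noteq> {}" using that k unfolding rich_def by auto
    then show ?thesis unfolding pick_def by (metis ex_in_conv someI_ex)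
  qed
  \<comment> \<open>By \<open>at_point\<close>, the preimage of a net point in the image of
    \<open>S\<close> lies on every line that the net point hits; elsewhere \<open>two\<close> bounds
    the number of picks.\<close>
  define rep where "rep p = (if p \<in> proj ` S then {v \<in> S. proj v = p} else pick ` {l \<in> rich. hits p l})" for p
  have fin_rich: "finite rich" using finite_lines unfolding rich_def by auto
  have rep2: "card (rep p) \<le> 2" for p
  proof (cases "p \<in> proj ` S")
    case True
    then obtain v where "v \<in> S" "p = proj v" by auto
    then have "{v \<in> S. proj v = p} = {v}" using injS by (auto simp: inj_on_def)
    then show ?thesis using True unfolding rep_def by simp
  next
    case False
    have "card (pick ` {l \<in> rich. hits p l}) \<le> card {l \<in> rich. hits p l}"
      using fin_rich by (intro card_image_le) auto
    then show ?thesis using two[OF False] False unfolding rep_def by simp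
  qed
  have repS: "rep p \<subseteq> S" for p using pick unfolding rep_def by auto
  define T' where "T' = (\<Union>p\<in>T. rep p)"
  have T'S: "T' \<subseteq> S" unfolding T'_def using repS by auto
  have cT': "card T' \<le> 2 * card T"
  proof -
    have "card T' \<le> (\<Sum>p\<in>T. card (rep p))" unfolding T'_def by (rule card_UN_le[OF T])
    also have "\<dots> \<le> (\<Sum>p\<in>T. 2)" using rep2 by (intro sum_mono)
    finally show ?thesis by simp
  qed
  have meets: "l \<inter> T' \<noteq> {}" if "l \<in> rich" for l
  proof -
    obtain p where p: "p \<in> T" "hits p l" using hit[OF \<open>l \<in> rich\<close>] by blast
    have "\<exists>v\<in>rep p. v \<in> l"
    proof (cases "p \<in> proj ` S")
      case True
      then obtain v where v: "v \<in> S" "p = proj v" by auto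
      then have "v \<in> l" using at_point p(2) S by blast
      then show ?thesis using v True unfolding rep_def by auto
    next
      case False
      then show ?thesis using pick[OF that] that p(2) unfolding rep_def by auto
    qed
    then show ?thesis using p(1) unfolding T'_def by blast
  qed
  have "\<not> card S \<le> 2 * card (S - T')"
  proof
    assume "card S \<le> 2 * card (S - T')"
    then obtain l where "l \<in> axis_lines" "k \<le> card (l \<inter> S)" "l \<inter> S \<subseteq> S - T'" using half[of "S - T'"] by auto
    then show False using meets[of l] T'S unfolding rich_def by blast
  qed
  moreover have "card (S - T') = card S - card T'"
    using T'S finS by (intro card_Diff_subset) (auto intro: finite_subset)
  ultimately show ?thesis using cT' by linarith
qed

end

lemma (in grid) exists_generic_projection: "\<exists>z. generic_projection n d z"
proof -
  obtain z where "\<forall>f\<in>forms. (\<Sum>a<d. \<Sum>b<d. f a b * (z a * z b)) = 0 \<longrightarrow>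
           (\<forall>\<alpha><d. \<forall>\<beta><d. f \<alpha> \<beta> + f \<beta> \<alpha> = 0)"
    using generic_slopes[OF finite_forms, of d] by blast
  then have "generic_projection n d z"
    by unfold_locales (auto simp: vanishes_def)
  then show ?thesis by blast
qed

section \<open>Choice of parameters\<close>

text \<open>The left side is the value \<open>a + b * K\<close> that bounds the iterated logarithm
  in the next lemma. With \<open>k = K + 1\<close> it is at most \<open>53 * k ^ 10\<close>, and 53
  is below \<open>2 ^ 10\<close>.\<close>

lemma exponent_bound:
  fixes K :: nat
  shows "(K + 10) * K + (9 + 2 * (K + 1) * (6 + (K + 1) + (K + 10) * K)) * K \<le> (2 * (K + 1)) ^ 10"
proof -
  define k where "k = K + 1"
  have k: "1 \<le> k" "K \<le> k" "K + 10 \<le> 10 * k" unfolding k_def by auto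
  have p: "k ^ i \<le> k ^ j" if "i \<le> j" for i j using k(1) that by (rule power_increasing[rotated])
  have "(K + 10) * K \<le> (10 * k) * k" using k by (intro mult_mono) auto
  then have a: "(K + 10) * K \<le> 10 * k ^ 2" by (simp add: power2_eq_square)
  have "6 + k + (K + 10) * K \<le> 17 * k ^ 2" using a p[of 0 2] p[of 1 2] by simp
  then have "2 * k * (6 + k + (K + 10) * K) \<le> 2 * k * (17 * k ^ 2)" by (rule mult_left_mono) simp
  also have "\<dots> = 34 * k ^ 3" by (simp add: power3_eq_cube power2_eq_square)
  finally have b: "9 + 2 * k * (6 + k + (K + 10) * K) \<le> 43 * k ^ 3" using p[of 0 3] by simp
  have "(9 + 2 * k * (6 + k + (K + 10) * K)) * K \<le> 43 * k ^ 3 * k" using b k(2) by (rule mult_mono) auto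
  also have "\<dots> = 43 * k ^ 4" by (simp add: power4_eq_xxxx power3_eq_cube)
  finally have "(K + 10) * K + (9 + 2 * k * (6 + k + (K + 10) * K)) * K \<le> 53 * k ^ 10"
    using a p[of 2 10] p[of 4 10] by linarith
  also have "\<dots> \<le> (2 * k) ^ 10" by (simp add: power_mult_distrib)
  finally show ?thesis unfolding k_def .
qed

text \<open>The parameters \<open>n\<close>, \<open>r\<close>, \<open>d\<close>, \<open>q\<close>
  are powers of two, so that \<open>n ^ d = 2 ^ (a * d)\<close> factors exactly as
  \<open>q * r\<close>.\<close>

lemma exists_resistant_point_set:
  fixes k :: nat
  assumes k2: "2 \<le> k"
  shows "\<exists>S :: (real \<times> real) set. finite S \<and> real k * real k \<le> real (card S) \<and>
     log 2 (log 2 (real (card S) / real k)) \<le> real ((2 * k) ^ 10) \<and>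
     (\<forall>T. finite T \<and> weak_eps_net_lines (real k / real (card S)) S T \<longrightarrow> card S \<le> 4 * card T)"
proof -
  define K where "K = k - 1"
  have K: "k = K + 1" "0 < K" using k2 unfolding K_def by auto
  define a where "a = (K + 10) * K"
  \<comment> \<open>Read off from \<open>r_large\<close>: \<open>300 \<le> 2 ^ 9\<close>,
    \<open>64 = 2 ^ 6\<close>, \<open>K + 1 \<le> 2 ^ (K + 1)\<close> and
    \<open>n = 2 ^ a\<close>.\<close>
  define b where "b = 9 + 2 * (K + 1) * (6 + (K + 1) + a)"
  define n :: nat where "n = (2 ^ (K + 10)) ^ K"
  define r :: nat where "r = 2 ^ b"
  define d where "d = r ^ K"
  define q :: nat where "q = 2 ^ (a * d - b)"
  have n: "n = 2 ^ a" unfolding n_def a_def by (simp add: power_mult)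
  have d: "d = 2 ^ (b * K)" unfolding d_def r_def by (simp add: power_mult)
  have a_pos: "1 \<le> a" using K(2) unfolding a_def by simp
  have b_pos: "0 < b" unfolding b_def by simp
  \<comment> \<open>This leads to \<open>2 * b \<le> a * d\<close>: the subtraction in
    \<open>q\<close> is not truncated, and \<open>q \<ge> 2 ^ b\<close> exceeds
    \<open>k\<close>.\<close>
  have "2 * b \<le> 2 ^ b"
  proof -
    have "b - 1 < 2 ^ (b - 1)" by (rule less_exp)
    moreover have "(2::nat) ^ b = 2 * 2 ^ (b - 1)" using power_Suc[of "2::nat" "b - 1"] b_pos by simp
    ultimately show ?thesis by linarith
  qed
  also have "(2::nat) ^ b \<le> 2 ^ (b * K)" using K(2) by (intro power_increasing) auto
  also have "\<dots> \<le> a * d" unfolding d using a_pos by simp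
  finally have ad: "2 * b \<le> a * d" .
  have kb: "k \<le> b" unfolding b_def K(1) by simp
  have card: "n ^ d = q * r" unfolding n q_def r_def using ad by (simp flip: power_mult power_add)
  have "k < 2 ^ k" by (rule less_exp)
  also have "(2::nat) ^ k \<le> q" unfolding q_def using ad kb by (intro power_increasing) auto
  finally have qk: "k \<le> q" by simp
  have r_large: "300 * (64 * (K + 1) * n) ^ (2 * (K + 1)) \<le> r"
  proof -
    have "K + 1 \<le> 2 ^ (K + 1)" using less_exp[of "K + 1"] by simp
    then have "64 * (K + 1) * n \<le> 2 ^ 6 * 2 ^ (K + 1) * 2 ^ a" unfolding n by (intro mult_mono) auto
    also have "\<dots> = 2 ^ (6 + (K + 1) + a)" by (simp add: power_add)
    finally have "(64 * (K + 1) * n) ^ (2 * (K + 1)) \<le> (2 ^ (6 + (K + 1) + a)) ^ (2 * (K + 1))"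
      by (rule power_mono) simp
    also have "\<dots> = 2 ^ (2 * (K + 1) * (6 + (K + 1) + a))" by (simp only: power_mult[symmetric] mult.commute)
    finally have "300 * (64 * (K + 1) * n) ^ (2 * (K + 1)) \<le> 2 ^ 9 * 2 ^ (2 * (K + 1) * (6 + (K + 1) + a))"
      by (intro mult_mono) auto
    then show ?thesis unfolding r_def b_def by (simp only: power_add)
  qed
  have r64: "64 \<le> r"
  proof -
    have "(2::nat) ^ 9 \<le> 2 ^ b" unfolding b_def by (intro power_increasing) auto
    then show ?thesis unfolding r_def by simp
  qed
  have r4: "4 dvd r"
  proof -
    have "(2::nat) ^ 2 dvd 2 ^ b" unfolding b_def by (intro le_imp_power_dvd) auto
    then show ?thesis unfolding r_def by simp
  qed
  have n2: "2 \<le> n"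
  proof -
    have "(2::nat) ^ 1 \<le> 2 ^ a" using a_pos by (intro power_increasing) auto
    then show ?thesis unfolding n by simp
  qed
  interpret grid n d by unfold_locales (use n2 d in auto)
  interpret sampling points axis_lines n d K r q
  proof unfold_locales
    show "n = (2 ^ (K + 10)) ^ K" by (rule n_def)
    show "d = r ^ K" by (rule d_def)
    show "4 \<le> r" using r64 by simp
    show "card points = q * r" using card_points card by simp
  qed (fact r4 r_large)+
  obtain S where S: "S \<subseteq> points" "9 * N \<le> 10 * card S" "card S \<le> N"
    and half: "\<forall>U\<subseteq>S. card S \<le> 2 * card U \<longrightarrow> (\<exists>l\<in>axis_lines. Suc K \<le> card (l \<inter> S) \<and> l \<inter> S \<subseteq> U)"
    and cross: "\<forall>l\<in>axis_lines. \<forall>l'\<in>axis_lines. \<forall>v. v \<in> l \<longrightarrow> v \<in> l' \<longrightarrow> v \<notin> S \<longrightarrow>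
        Suc K \<le> card (l \<inter> S) \<longrightarrow> Suc K \<le> card (l' \<inter> S) \<longrightarrow> l = l'"
    using sparse_hitting_resistant_set by (elim exE conjE) (rule that)
  obtain z where "generic_projection n d z" using exists_generic_projection by blast
  then interpret generic_projection n d z .
  have finS: "finite S" using S(1) finite_points finite_subset by blast
  have cp: "card (proj ` S) = card S" using inj_on_proj S(1) by (intro card_image) (rule inj_on_subset)
  have N: "N = 64 * k * q" unfolding K(1) by simp
  have "k * k \<le> k * q" using qk by simp
  then have low: "k * k \<le> card S" "2 * k \<le> card S" using S(2) N k2 mult_le_mono1[OF k2, of k] by linarith+
  have kpos: "0 < real k" using k2 by simp
  have ge2: "2 \<le> real (card S) / real k" using low(2) kpos by (simp add: field_simps flip: of_nat_mult)
  \<comment> \<open>Here \<open>card S / k \<le> 64 * q \<le> n ^ d = 2 ^ (a * d)\<close> and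
    \<open>a * d \<le> 2 ^ (a + b * K)\<close>, so two logarithms leave
    \<open>a + b * K\<close>.\<close>
  have "card S \<le> k * (64 * q)" unfolding K(1) using S(3) by (simp add: mult_ac)
  also have "\<dots> \<le> k * (n ^ d)" unfolding card using r64 by (intro mult_left_mono) auto
  finally have "real (card S) \<le> real (k * n ^ d)" by (rule of_nat_mono)
  then have "real (card S) \<le> real k * 2 ^ (a * d)" unfolding n by (simp add: power_mult)
  then have "real (card S) / real k \<le> 2 powr real (a * d)"
    using kpos by (simp add: powr_realpow pos_divide_le_eq mult.commute del: of_nat_mult)
  then have "log 2 (real (card S) / real k) \<le> real (a * d)"
    using ge2 by (simp add: log_le_iff)
  also have "\<dots> \<le> real (2 ^ (a + b * K))"
  proof -
    have "a * d \<le> 2 ^ a * 2 ^ (b * K)" unfolding d using less_exp[of a] by (intro mult_right_mono) auto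
    then show ?thesis by (simp only: of_nat_le_iff power_add)
  qed
  finally have "log 2 (real (card S) / real k) \<le> 2 powr real (a + b * K)"
    by (simp add: powr_realpow del: of_nat_add of_nat_mult)
  moreover have "1 \<le> log 2 (real (card S) / real k)" using ge2 by (simp add: le_log_iff)
  ultimately have "log 2 (log 2 (real (card S) / real k)) \<le> real (a + b * K)" by (simp add: log_le_iff)
  also have "\<dots> \<le> real ((2 * k) ^ 10)"
    using exponent_bound[of K] unfolding a_def b_def K(1) by (simp only: of_nat_le_iff)
  finally have loglog: "log 2 (log 2 (real (card S) / real k)) \<le> real ((2 * k) ^ 10)" .
  have "card S \<le> 4 * card T" if T: "finite T" "weak_eps_net_lines (real k / real (card S)) (proj ` S) T" for T
  proof (rule weak_net_large[OF S(1), of k])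
    show "real k / real (card S) * real (card S) = real k" using low k2 by simp
  qed (use half cross T k2 in \<open>auto simp: K(1)\<close>)
  then show ?thesis
    using finS low(1) loglog by (intro exI[of _ "proj ` S"]) (auto simp: cp simp flip: of_nat_mult)
qed

text \<open>\<open>T\<close> is taken finite because \<open>card\<close> is 0 on infinite sets,
  whose true cardinality satisfies the bound trivially.\<close>

theorem theorem2p3:
  shows "\<exists>\<delta>>0. \<forall>eps0. 0 < eps0 \<and> eps0 < \<delta> \<longrightarrow>
           (\<exists>eps. 0 < eps \<and> eps < eps0 \<and>
              (\<exists>S :: (real \<times> real) set. finite S \<and> S \<noteq> {} \<and>
                 (\<forall>T. finite T \<and> weak_eps_net_lines eps S T \<longrightarrow>
                    real (card T) \<ge> 1 / (10 * eps) * (log 2 (log 2 (1 / eps))) powr (1/10))))"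
proof (rule exI[of _ 1], intro conjI allI impI)
  fix eps0 :: real
  assume "0 < eps0 \<and> eps0 < 1"
  then have eps0: "0 < eps0" by simp
  \<comment> \<open>A large \<open>k\<close> makes \<open>eps = k / card S \<le> 1 / k\<close>
    smaller than \<open>eps0\<close>.\<close>
  obtain k' :: nat where k': "1 / eps0 < real k'" using reals_Archimedean2 by blast
  define k where "k = k' + 2"
  have k2: "2 \<le> k" and kpos: "0 < real k" and keps: "1 / eps0 < real k" using k' unfolding k_def by auto
  obtain S :: "(real \<times> real) set" where S: "finite S" "real k * real k \<le> real (card S)"
      "log 2 (log 2 (real (card S) / real k)) \<le> real ((2 * k) ^ 10)"
    and net: "\<And>T. finite T \<Longrightarrow> weak_eps_net_lines (real k / real (card S)) S T \<Longrightarrow> card S \<le> 4 * card T"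
    using exists_resistant_point_set[OF k2] by blast
  define eps where "eps = real k / real (card S)"
  have cpos: "0 < real (card S)" using S(2) kpos by (meson mult_pos_pos order_less_le_trans)
  have pos: "0 < eps" unfolding eps_def using cpos kpos by simp
  have "eps \<le> 1 / real k" unfolding eps_def using S(2) cpos kpos by (simp add: field_simps)
  also have "\<dots> < eps0" using keps eps0 kpos by (simp add: field_simps)
  finally have less: "eps < eps0" .
  have inv: "1 / eps = real (card S) / real k" unfolding eps_def by simp
  have root: "log 2 (log 2 (1 / eps)) powr (1 / 10) \<le> 2 * real k"
  proof -
    have "2 * real k \<le> real k * real k" using k2 by (intro mult_right_mono) auto
    then have "2 * real k \<le> real (card S)" using S(2) by linarith
    then have "2 \<le> 1 / eps" unfolding inv using kpos by (simp add: field_simps)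
    then have "1 \<le> log 2 (1 / eps)" using pos by (simp add: le_log_iff)
    then have "0 \<le> log 2 (log 2 (1 / eps))" by simp
    then have "log 2 (log 2 (1 / eps)) powr (1 / 10) \<le> real ((2 * k) ^ 10) powr (1 / 10)"
      using S(3) inv by (intro powr_mono2) auto
    also have "\<dots> = ((2 * real k) powr 10) powr (1 / 10)" using kpos by (simp add: powr_numeral)
    also have "\<dots> = (2 * real k) powr (10 * (1 / 10))" by (rule powr_powr)
    also have "\<dots> = 2 * real k" using kpos by simp
    finally show ?thesis .
  qed
  show "\<exists>eps>0. eps < eps0 \<and> (\<exists>S :: (real \<times> real) set. finite S \<and> S \<noteq> {} \<and>
                 (\<forall>T. finite T \<and> weak_eps_net_lines eps S T \<longrightarrow>
                    real (card T) \<ge> 1 / (10 * eps) * (log 2 (log 2 (1 / eps))) powr (1/10)))"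
  proof (intro exI[of _ eps] exI[of _ S] conjI allI impI)
    show "S \<noteq> {}" using cpos by auto
    fix T assume T: "finite T \<and> weak_eps_net_lines eps S T"
    \<comment> \<open>As \<open>card S = k / eps\<close> and the root is at most
      \<open>2 * k\<close>, the claimed bound is at most \<open>card S / 5\<close>, within the
      available \<open>card S / 4\<close>.\<close>
    have "1 / (10 * eps) * log 2 (log 2 (1 / eps)) powr (1 / 10) \<le> 1 / (10 * eps) * (2 * real k)"
      using root pos by (intro mult_left_mono) auto
    also have "\<dots> = real (card S) / 5" unfolding eps_def using kpos by simp
    also have "\<dots> \<le> real (card T)" using net[of T] T unfolding eps_def by linarith
    finally show "1 / (10 * eps) * log 2 (log 2 (1 / eps)) powr (1 / 10) \<le> real (card T)" .
  qed (fact pos less S(1))+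
qed simp

end
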